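(* Let $k \ge t \ge 2$ be fixed integers. For each sufficiently large $v$, let $\mathcal{C}_v$ be the $(v,k,t)$ covering produced by the induced covering algorithm. Then the expected density of $\mathcal{C}_v$ is $1 + o(1)$ as $v \to \infty$.
   Context: A $(v,k,t)$ covering is a family of $k$-subsets, called blocks, of a fixed $v$-set such that every $t$-subset of the $v$-set is contained in at least one block. Its density is the average, over all $t$-subsets, of the number of blocks containing the $t$-subset; equivalently, $(\text{number of blocks}) \cdot \binom{k}{t} / \binom{v}{t}$ (blocks counted with multiplicity). Random greedy $(n,k,t)$ covering algorithm: (1) Fix a uniformly random ordering of all $k$-subsets of an $n$-set. (2) Choose the earliest $k$-set that contains no already-covered $t$-set (a $t$-set is already covered if it is contained in a previously chosen $k$-set). (3) Repeat step (2) until no $k$-set can be chosen. (4) For each still-uncovered $t$-set, add one $k$-set containing it. Induced $(v,k,t)$ covering algorithm: (1) Put $\ell = \frac{1}{9} v^{1-1/t}$ and choose a prime $p$ with $4\ell \le (v-t)/p \le 8\ell$ (such a prime exists by Bertrand's Postulate, and $p^t > v$ for $v$ large). (2) For every integer $\ell'$ with $\ell < \ell' < 9\ell$, precompute an $(\ell',k,t)$ covering using the random greedy covering algorithm, keeping the smallest covering obtained in $r$ independent runs, where $r \ge 1$ and $r = O(\log \ell)$. (3) Choose a uniformly random set $V$ of $v$ points of the affine geometry $\mathrm{AG}(t,p)$ (the $t$-dimensional affine space over the field with $p$ elements). (4) For each (affine) hyperplane $H$ of $\mathrm{AG}(t,p)$, let $\ell' = |H \cap V|$. If $\ell < \ell'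 < 9\ell$, add to the output the blocks of the precomputed $(\ell',k,t)$ covering, placed on the points of $H \cap V$. If $\ell' \le \ell$ or $\ell' \ge 9\ell$, add $\binom{\ell'}{t}$ blocks, namely for each $t$-subset of $H \cap V$ one $k$-subset of $V$ containing it. The output is a $(v,k,t)$ covering on the $v$-set $V$. The expectation is over all random choices of the algorithm. *)

theory Defs
  imports
    "HOL-Probability.Probability"
    "HOL-Combinatorics.Multiset_Permutations"
    "HOL-Library.Ramsey"
    "HOL-Library.While_Combinator"
    "HOL-Library.Landau_Symbols"
    "HOL-Number_Theory.Cong"
begin

text \<open>
  Families of blocks are multisets of sets, so blocks are counted with multiplicity.
  The set of all \<open>k\<close>-subsets of \<open>X\<close> is \<^term>\<open>nsets X k\<close>.
\<close>

definition covering_density :: "nat \<Rightarrow> 'a set \<Rightarrow> 'a set multiset \<Rightarrow> real" where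
  "covering_density t X \<B> =
     (\<Sum>T\<in>nsets X t. real (size {#B \<in># \<B>. T \<subseteq> B#})) / real (card (nsets X t))"


subsection \<open>The random greedy covering algorithm\<close>

definition covered :: "'a set set \<Rightarrow> 'a set \<Rightarrow> bool" where
  "covered C T \<longleftrightarrow> (\<exists>B\<in>C. T \<subseteq> B)"

definition admissible :: "nat \<Rightarrow> 'a set set \<Rightarrow> 'a set \<Rightarrow> bool" where
  "admissible t C B \<longleftrightarrow> (\<forall>T\<in>nsets B t. \<not> covered C T)"

text \<open>
  The ordering of the \<open>k\<close>-subsets is a list \<open>xs\<close>. A chosen \<open>k\<close>-set is never admissible again
  when \<open>t \<le> k\<close>, so the loop terminates and the chosen blocks may be collected in a set.
\<close>

definition greedy_packing :: "nat \<Rightarrow> 'a set list \<Rightarrow> 'a set set" where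
  "greedy_packing t xs =
     while (\<lambda>C. \<exists>B\<in>set xs. admissible t C B)
           (\<lambda>C. insert (the (find (admissible t C) xs)) C) {}"

text \<open>
  The choice of the \<open>k\<close>-sets for the remaining \<open>t\<close>-sets is left open by the algorithm: the relation
  holds for every family that can result from the ordering \<open>xs\<close>.
  One block is added for each \<open>t\<close>-set left uncovered by the packing, even if two of these
  blocks coincide.
\<close>

definition greedy_result :: "'a set \<Rightarrow> nat \<Rightarrow> nat \<Rightarrow> 'a set list \<Rightarrow> 'a set multiset \<Rightarrow> bool" where
  "greedy_result X k t xs \<B> \<longleftrightarrow>
     (\<exists>f. (\<forall>T\<in>nsets X t. f T \<in> nsets X k \<and> T \<subseteq> f T) \<and>
          \<B> = mset_set (greedy_packing t xs) +
              image_mset f (mset_set {T \<in> nsets X t. \<not> covered (greedy_packing t xs) T}))"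

text \<open>A smallest result of \<open>r\<close> runs on \<open>{..<n}\<close>; the \<open>i\<close>-th run uses the ordering \<open>xss i\<close>.\<close>

definition best_greedy_result ::
  "nat \<Rightarrow> nat \<Rightarrow> nat \<Rightarrow> nat \<Rightarrow> (nat \<Rightarrow> nat set list) \<Rightarrow> nat set multiset \<Rightarrow> bool" where
  "best_greedy_result n k t r xss \<B> \<longleftrightarrow>
     (\<exists>runs. (\<forall>i<r. greedy_result {..<n} k t (xss i) (runs i)) \<and>
             (\<exists>i<r. \<B> = runs i \<and> (\<forall>j<r. size (runs i) \<le> size (runs j))))"


subsection \<open>The affine geometry \<open>AG(t,p)\<close>\<close>

text \<open>Coordinates are the representatives \<open>0, \<dots>, p - 1\<close> of the residue classes modulo \<open>p\<close>.\<close>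

type_synonym point = "nat \<Rightarrow> int"

definition AG :: "nat \<Rightarrow> nat \<Rightarrow> point set" where
  "AG t p = ({..<t} \<rightarrow>\<^sub>E {0..<int p})"

definition hyperplanes :: "nat \<Rightarrow> nat \<Rightarrow> point set set" where
  "hyperplanes t p =
     {H. \<exists>a c. (\<exists>i<t. \<not> [a i = 0] (mod int p)) \<and>
               H = {x \<in> AG t p. [(\<Sum>i<t. a i * x i) = c] (mod int p)}}"


subsection \<open>The induced covering algorithm\<close>

definition ell :: "nat \<Rightarrow> nat \<Rightarrow> real" where
  "ell t v = 1/9 * real v powr (1 - 1 / real t)"

definition medium :: "nat \<Rightarrow> nat \<Rightarrow> nat \<Rightarrow> bool" where
  "medium t v l' \<longleftrightarrow> ell t v < real l' \<and> real l' < 9 * ell t v"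

definition prime_choice :: "nat \<Rightarrow> nat \<Rightarrow> nat \<Rightarrow> bool" where
  "prime_choice t v p \<longleftrightarrow> prime p \<and>
     4 * ell t v \<le> (real v - real t) / real p \<and> (real v - real t) / real p \<le> 8 * ell t v"

text \<open>
  The random input: independently, a uniformly random ordering of the \<open>k\<close>-subsets of \<open>{..<l'}\<close>
  for every medium \<open>l'\<close> and every run \<open>i < r\<close>, and a uniformly random \<open>v\<close>-set of points.
\<close>

definition random_input ::
  "nat \<Rightarrow> nat \<Rightarrow> nat \<Rightarrow> nat \<Rightarrow> nat \<Rightarrow> ((nat \<times> nat \<Rightarrow> nat set list) \<times> point set) pmf" where
  "random_input k t p r v =
     pair_pmf
       (Pi_pmf ({l'. medium t v l'} \<times> {..<r}) []
          (\<lambda>(l', i). pmf_of_set (permutations_of_set (nsets {..<l'} k))))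
       (pmf_of_set (nsets (AG t p) v))"

definition hyperplane_blocks ::
  "nat \<Rightarrow> nat \<Rightarrow> nat \<Rightarrow> (nat \<Rightarrow> nat set multiset) \<Rightarrow> point set \<Rightarrow> point set
     \<Rightarrow> point set multiset \<Rightarrow> bool" where
  "hyperplane_blocks k t v P V H \<B> \<longleftrightarrow>
     (let S = H \<inter> V in
      if medium t v (card S)
      then \<exists>\<phi>. bij_betw \<phi> {..<card S} S \<and> \<B> = image_mset (image \<phi>) (P (card S))
      else \<exists>f. (\<forall>T\<in>nsets S t. f T \<in> nsets V k \<and> T \<subseteq> f T) \<and>
               \<B> = image_mset f (mset_set (nsets S t)))"

text \<open>
  \<open>P l'\<close> is the precomputed \<open>(l',k,t)\<close> covering, shared by all hyperplanes meeting \<open>V\<close> in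
  \<open>l'\<close> points.
\<close>

definition induced_result ::
  "nat \<Rightarrow> nat \<Rightarrow> nat \<Rightarrow> nat \<Rightarrow> nat \<Rightarrow> (nat \<times> nat \<Rightarrow> nat set list) \<Rightarrow> point set
     \<Rightarrow> point set multiset \<Rightarrow> bool" where
  "induced_result k t p r v \<omega> V \<C> \<longleftrightarrow>
     (\<exists>P Q. (\<forall>l'. medium t v l' \<longrightarrow> best_greedy_result l' k t r (\<lambda>i. \<omega> (l', i)) (P l')) \<and>
            (\<forall>H\<in>hyperplanes t p. hyperplane_blocks k t v P V H (Q H)) \<and>
            \<C> = (\<Sum>H\<in>hyperplanes t p. Q H))"

text \<open>
  \<open>D\<close> is the joint distribution of \<open>V\<close> and the covering on \<open>V\<close> produced by some implementation of
  the algorithm. Through the coupling in \<^const>\<open>rel_pmf\<close>, the choices that the algorithm leaves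
  open may depend on the random input in any way and may themselves be random.
\<close>

definition induced_algorithm ::
  "nat \<Rightarrow> nat \<Rightarrow> nat \<Rightarrow> nat \<Rightarrow> nat \<Rightarrow> (point set \<times> point set multiset) pmf \<Rightarrow> bool" where
  "induced_algorithm k t p r v D \<longleftrightarrow>
     rel_pmf (\<lambda>(\<omega>, V) (V', \<C>). V' = V \<and> induced_result k t p r v \<omega> V \<C>)
       (random_input k t p r v) D"

end

theory Submission
  imports Defs "HOL-Real_Asymp.Real_Asymp"
begin

text \<open>
  The heart of the matter is that the random greedy packing leaves only \<open>o(n choose t)\<close> of the
  \<open>t\<close>-sets uncovered. For a family \<open>F\<close> of \<open>t\<close>-sets let \<open>\<phi> i F\<close> be the probability that no member of \<open>F\<close>
  is covered after the first \<open>i\<close> of the \<open>K\<close> blocks of the ordering. The next block is uniform among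
  the remaining ones, and a block that was looked at is never admissible again, so exactly
  \<open>\<phi> (i + 1) F = \<phi> i F - (\<Sum>e. \<phi> i (F \<union> nsets e t)) / (K - i)\<close>, where \<open>e\<close> runs over the blocks that
  contain a member of \<open>F\<close>. Up to lower order terms this hierarchy depends on \<open>card F\<close> only: with
  \<open>q = (k choose t) - 1\<close> and suitably scaled time, its limit is \<open>g' m = - m * g (m + q)\<close> for families
  of \<open>m\<close> sets, which is solved by \<open>g m x = (1 + q * x) powr (- m / q)\<close>. Iterating the integrated
  hierarchy bounds the error on a time interval of length \<open>1 / (2 * q)\<close> by the remainder of a
  convergent power series; finitely many such intervals reach any fixed time, and \<open>g 1 x\<close> tends to
  \<open>0\<close> as \<open>x\<close> grows.

  The best of several runs is no worse than the first one, so a medium hyperplane with \<open>l\<close> points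
  costs \<open>(1 + o(1)) * (l choose t) / (k choose t)\<close> blocks in expectation. Up to the factor
  \<open>1 + o(1)\<close>, a random \<open>v\<close>-set has \<open>v choose t\<close> pairs of a hyperplane and a \<open>t\<close>-set on it in
  expectation, and hyperplanes that are not medium contribute a vanishing fraction of them by
  Chebyshev's inequality. The density is at least \<open>1\<close> because any \<open>t\<close> points lie on a hyperplane.
\<close>

subsection \<open>Random greedy packings\<close>

definition greedy :: "nat \<Rightarrow> 'a set list \<Rightarrow> 'a set set" where
  "greedy t xs = foldl (\<lambda>C B. if admissible t C B then insert B C else C) {} xs"

lemma greedy_Nil [simp]: "greedy t [] = {}"
  by (simp add: greedy_def)

lemma greedy_snoc: "greedy t (xs @ [B]) =
    (if admissible t (greedy t xs) B then insert B (greedy t xs) else greedy t xs)"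
  by (simp add: greedy_def)

lemma covered_mono: "covered C T \<Longrightarrow> C \<subseteq> C' \<Longrightarrow> covered C' T"
  by (auto simp: covered_def)

lemma admissible_antimono: "admissible t C' B \<Longrightarrow> C \<subseteq> C' \<Longrightarrow> admissible t C B"
  by (auto simp: admissible_def covered_def)

lemma greedy_mono: "greedy t xs \<subseteq> greedy t (xs @ ys)"
proof (induction ys rule: rev_induct)
  case (snoc y ys)
  then show ?case by (auto simp: greedy_snoc simp flip: append_assoc)
qed simp

lemma greedy_subset: "greedy t xs \<subseteq> set xs"
  by (induction xs rule: rev_induct) (auto simp: greedy_snoc)

lemma admissible_insert_self: "nsets B t \<noteq> {} \<Longrightarrow> \<not> admissible t (insert B C) B"
  by (auto simp: admissible_def covered_def nsets_def)

text \<open>When \<open>B\<close> was read it was either chosen, and then covers its own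
  \<open>t\<close>-sets, or it was already inadmissible. Both persist because the family only
  grows.\<close>

lemma not_admissible_greedy:
  assumes "B \<in> set xs" "nsets B t \<noteq> {}"
  shows "\<not> admissible t (greedy t xs) B"
proof -
  obtain ys zs where xs: "xs = ys @ B # zs" using assms(1) by (meson split_list)
  have "\<not> admissible t (greedy t (ys @ [B])) B"
    using admissible_insert_self[OF assms(2)] by (auto simp: greedy_snoc)
  moreover have "greedy t (ys @ [B]) \<subseteq> greedy t xs"
    using greedy_mono[of t "ys @ [B]" zs] xs by simp
  ultimately show ?thesis using admissible_antimono by blast
qed

lemma find_append_first:
  assumes "\<forall>x\<in>set ys. \<not> P x" "P z"
  shows "find P (ys @ z # zs) = Some z"
  using assms by (induction ys) auto

text \<open>Induction on the unread part \<open>zs\<close>: the loop started in the state reached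
  after \<open>ys\<close> ends in \<open>greedy t xs\<close>. An inadmissible next block leaves the
  state unchanged; an admissible one is exactly what \<open>find\<close> returns, since everything
  in \<open>ys\<close> is inadmissible by then.\<close>

lemma greedy_packing_eq_greedy:
  assumes "\<And>B. B \<in> set xs \<Longrightarrow> nsets B t \<noteq> {}"
  shows "greedy_packing t xs = greedy t xs"
proof -
  have "while (\<lambda>C. \<exists>B\<in>set xs. admissible t C B)
           (\<lambda>C. insert (the (find (admissible t C) xs)) C) (greedy t ys) = greedy t xs"
    if "xs = ys @ zs" for ys zs
    using that
  proof (induction zs arbitrary: ys)
    case Nil
    then have "\<not> (\<exists>B\<in>set xs. admissible t (greedy t ys) B)"
      using not_admissible_greedy assms by (metis append.right_neutral)
    then show ?case using Nil by (subst while_unfold) simp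
  next
    case (Cons z zs)
    have eq: "xs = (ys @ [z]) @ zs" using Cons.prems by simp
    show ?case
    proof (cases "admissible t (greedy t ys) z")
      case True
      have "\<forall>B\<in>set ys. \<not> admissible t (greedy t ys) B"
        using not_admissible_greedy[of _ ys t] assms Cons.prems by simp
      then have "find (admissible t (greedy t ys)) xs = Some z"
        using find_append_first[of ys "admissible t (greedy t ys)" z zs] True Cons.prems by simp
      moreover have "\<exists>B\<in>set xs. admissible t (greedy t ys) B" using True Cons.prems by auto
      ultimately show ?thesis
        using Cons.IH[OF eq] True by (subst while_unfold) (simp add: greedy_snoc)
    next
      case False
      then show ?thesis using Cons.IH[OF eq] by (simp add: greedy_snoc)
    qed
  qed
  from this[of "[]" xs] show ?thesis by (simp add: greedy_packing_def)
qed

lemma greedy_disjoint: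
  "\<lbrakk>B \<in> greedy t xs; B' \<in> greedy t xs; B \<noteq> B'\<rbrakk> \<Longrightarrow> nsets B t \<inter> nsets B' t = {}"
proof (induction xs rule: rev_induct)
  case (snoc x xs)
  have *: "nsets x t \<inter> nsets B t = {}" if "admissible t (greedy t xs) x" "B \<in> greedy t xs" for B
    using that by (auto simp: admissible_def covered_def nsets_def)
  show ?case using snoc * by (auto simp: greedy_snoc split: if_splits)
qed simp

text \<open>The packing bound: chosen blocks have pairwise disjoint sets of
  \<open>t\<close>-subsets, each of size \<open>k choose t\<close>, all inside
  \<open>nsets X t\<close>.\<close>

lemma card_greedy_le:
  assumes "finite X" "set xs \<subseteq> nsets X k" "t \<le> k"
  shows "real (card (greedy t xs)) * real (k choose t) \<le> real (card X choose t)"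
proof -
  have sub: "greedy t xs \<subseteq> nsets X k" using greedy_subset assms(2) by blast
  then have fin: "finite (greedy t xs)" using finite_imp_finite_nsets[OF assms(1)] finite_subset by blast
  have fB: "finite B" "card B = k" "B \<subseteq> X" if "B \<in> greedy t xs" for B
    using that sub by (auto simp: nsets_def)
  have "card (\<Union>B\<in>greedy t xs. nsets B t) = (\<Sum>B\<in>greedy t xs. card (nsets B t))"
  proof (rule card_UN_disjoint)
    show "\<forall>B\<in>greedy t xs. \<forall>B'\<in>greedy t xs. B \<noteq> B' \<longrightarrow> nsets B t \<inter> nsets B' t = {}"
      using greedy_disjoint by blast
    show "\<forall>B\<in>greedy t xs. finite (nsets B t)" using fB(1) finite_imp_finite_nsets by blast
  qed (rule fin)
  also have "\<dots> = (\<Sum>B\<in>greedy t xs. k choose t)"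
    using fB(2) by (intro sum.cong) auto
  finally have "card (greedy t xs) * (k choose t) = card (\<Union>B\<in>greedy t xs. nsets B t)" by simp
  also have "\<dots> \<le> card (nsets X t)"
  proof (rule card_mono)
    show "finite (nsets X t)" using assms(1) by (rule finite_imp_finite_nsets)
    show "(\<Union>B\<in>greedy t xs. nsets B t) \<subseteq> nsets X t" using fB(3) nsets_mono by blast
  qed
  finally show ?thesis by (simp flip: of_nat_mult)
qed

text \<open>The size of every \<open>greedy_result\<close> for the ordering \<open>xs\<close>,
  whichever blocks are picked for the uncovered \<open>t\<close>-sets. Sizes thus become a function
  of the ordering alone.\<close>

definition greedy_size :: "nat \<Rightarrow> 'a set \<Rightarrow> 'a set list \<Rightarrow> nat" where
  "greedy_size t X xs = card (greedy t xs) + card {T\<in>nsets X t. \<not> covered (greedy t xs) T}"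

section \<open>Survival probabilities of families of \<open>t\<close>-sets\<close>

definition uncovered_all :: "nat \<Rightarrow> 'a set list \<Rightarrow> 'a set set \<Rightarrow> bool" where
  "uncovered_all t xs F \<longleftrightarrow> (\<forall>T\<in>F. \<not> covered (greedy t xs) T)"

text \<open>The quantity \<phi> of the overview. Families are needed because the recursion for a
  single \<open>t\<close>-set already involves the \<open>t\<close>-sets of whole blocks.\<close>

definition survival :: "'a set \<Rightarrow> nat \<Rightarrow> nat \<Rightarrow> nat \<Rightarrow> 'a set set \<Rightarrow> real" where
  "survival X k t i F =
     measure_pmf.prob (pmf_of_set (permutations_of_set (nsets X k)))
       {xs. uncovered_all t (take i xs) F}"

text \<open>Exchanging the entries at positions \<open>i\<close> and \<open>j\<close> is an
  involution on permutations that does not touch the first \<open>i\<close> entries.\<close>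

lemma permutations_swap_invariant:
  assumes "j < card E" "i \<le> j"
  shows "card {xs\<in>permutations_of_set E. P (take i xs) \<and> xs ! j = e} =
         card {xs\<in>permutations_of_set E. P (take i xs) \<and> xs ! i = e}"
proof (rule bij_betw_same_card)
  define s :: "'a list \<Rightarrow> 'a list" where "s = (\<lambda>xs. xs[i := xs ! j, j := xs ! i])"
  have len: "length xs = card E" if "xs \<in> permutations_of_set E" for xs
    using that by (rule length_finite_permutations_of_set)
  have nth: "s xs ! l = (if l = j then xs ! i else if l = i then xs ! j else xs ! l)"
    "length (s xs) = card E" if "length xs = card E" for l and xs :: "'a list"
    using that assms by (simp_all add: s_def nth_list_update)
  have ss: "s (s xs) = xs" if "length xs = card E" for xs
    by (rule nth_equalityI) (auto simp: nth[OF nth(2)[OF that]] nth[OF that] that)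
  have tk: "take i (s xs) = take i xs" for xs
    using assms by (simp add: s_def)
  have pm: "s xs \<in> permutations_of_set E" if "xs \<in> permutations_of_set E" for xs
    using that assms len[OF that] by (simp add: permutations_of_set_def s_def)
  show "bij_betw s {xs\<in>permutations_of_set E. P (take i xs) \<and> xs ! j = e}
      {xs\<in>permutations_of_set E. P (take i xs) \<and> xs ! i = e}"
    by (rule bij_betw_byWitness[where f' = s]) (auto simp: ss len tk pm nth)
qed

text \<open>Given the first \<open>i\<close> entries of a random permutation, the next one is uniform among the rest.\<close>

lemma card_permutations_next:
  assumes "i < card E" "e \<in> E"
  shows "(card E - i) * card {xs\<in>permutations_of_set E. P (take i xs) \<and> xs ! i = e} =
         card {xs\<in>permutations_of_set E. P (take i xs) \<and> e \<notin> set (take i xs)}"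
proof -
  let ?A = "\<lambda>j. {xs\<in>permutations_of_set E. P (take i xs) \<and> xs ! j = e}"
  have perm: "distinct xs" "length xs = card E" "set xs = E" if "xs \<in> permutations_of_set E" for xs
    using that length_finite_permutations_of_set[OF that] by (simp_all add: permutations_of_set_def)
  have pos: "xs ! j \<in> set (take i xs) \<longleftrightarrow> j < i" if "xs \<in> permutations_of_set E" "j < card E" for xs j
  proof
    assume "xs ! j \<in> set (take i xs)"
    then obtain l where "l < i" "l < length xs" "xs ! l = xs ! j" by (auto simp: in_set_conv_nth)
    then show "j < i" using nth_eq_iff_index_eq[of xs l j] perm[OF that(1)] that(2) by simp
  next
    assume "j < i"
    then show "xs ! j \<in> set (take i xs)"
      using perm[OF that(1)] that(2) by (metis in_set_conv_nth length_take min_less_iff_conj nth_take)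
  qed
  \<comment> \<open>If \<open>e\<close> is not among the first \<open>i\<close> entries, it stands
    at exactly one of the \<open>card E - i\<close> later positions; by the swap all of these
    positions are equally frequent.\<close>
  have "{xs\<in>permutations_of_set E. P (take i xs) \<and> e \<notin> set (take i xs)} = (\<Union>j\<in>{i..<card E}. ?A j)"
  proof (rule set_eqI)
    fix xs
    show "xs \<in> {xs\<in>permutations_of_set E. P (take i xs) \<and> e \<notin> set (take i xs)} \<longleftrightarrow>
        xs \<in> (\<Union>j\<in>{i..<card E}. ?A j)"
    proof (cases "xs \<in> permutations_of_set E")
      case True
      then obtain l where l: "l < card E" "xs ! l = e" using assms(2) perm[OF True] by (metis in_set_conv_nth)
      have "j = l" if "j < card E" "xs ! j = e" for j
        using nth_eq_iff_index_eq[of xs j l] perm[OF True] l that by simp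
      then have "(\<exists>j\<in>{i..<card E}. xs ! j = e) \<longleftrightarrow> i \<le> l"
        by (metis atLeastLessThan_iff l)
      then show ?thesis using pos[OF True l(1)] l(2) True by auto
    qed auto
  qed
  also have "card \<dots> = (\<Sum>j\<in>{i..<card E}. card (?A j))"
  proof (rule card_UN_disjoint)
    have "x = y" if "xs \<in> ?A x" "xs \<in> ?A y" "x < card E" "y < card E" for x y xs
      using that perm[of xs] nth_eq_iff_index_eq[of xs x y] by simp
    then show "\<forall>x\<in>{i..<card E}. \<forall>y\<in>{i..<card E}. x \<noteq> y \<longrightarrow> ?A x \<inter> ?A y = {}"
      unfolding disjoint_iff by (meson atLeastLessThan_iff)
    have "finite (?A j)" for j
      by (rule finite_subset[OF _ finite_permutations_of_set[of E]]) (rule Collect_restrict)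
    then show "\<forall>j\<in>{i..<card E}. finite (?A j)" by blast
  qed simp
  also have "\<dots> = (\<Sum>j\<in>{i..<card E}. card (?A i))"
    by (rule sum.cong[OF refl], rule permutations_swap_invariant) simp_all
  finally show ?thesis by simp
qed

lemma set_pmf_random_order:
  assumes "finite X"
  shows "set_pmf (pmf_of_set (permutations_of_set (nsets X k))) = permutations_of_set (nsets X k)"
  using finite_imp_finite_nsets[OF assms, of k]
  by (intro set_pmf_of_set) (simp_all add: permutations_of_set_empty_iff)

lemma survival_altdef:
  assumes "finite X"
  shows "survival X k t i F =
    real (card {xs\<in>permutations_of_set (nsets X k). uncovered_all t (take i xs) F}) /
    fact (card (nsets X k))"
proof -
  have "permutations_of_set (nsets X k) \<noteq> {}"
    using finite_imp_finite_nsets[OF assms] by (simp add: permutations_of_set_empty_iff)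
  then show ?thesis
    using finite_imp_finite_nsets[OF assms, of k]
    by (simp add: survival_def measure_pmf_of_set Int_def)
qed

lemma survival_bounds: "0 \<le> survival X k t i F" "survival X k t i F \<le> 1"
  by (auto simp: survival_def)

lemma survival_0: "survival X k t 0 F = 1"
  by (simp add: survival_def uncovered_all_def covered_def)

lemma uncovered_all_Un:
  "uncovered_all t xs (F \<union> G) \<longleftrightarrow> uncovered_all t xs F \<and> uncovered_all t xs G"
  by (auto simp: uncovered_all_def)

lemma admissible_iff_uncovered_all:
  "admissible t (greedy t xs) B \<longleftrightarrow> uncovered_all t xs (nsets B t)"
  by (auto simp: uncovered_all_def admissible_def)

text \<open>\<open>F\<close> ceases to survive at step \<open>i\<close> exactly when the next block
  \<open>e\<close> is admissible and contains a member of \<open>F\<close>. Admissibility means that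
  \<open>nsets e t\<close> is uncovered, so together with the survival of \<open>F\<close> it is the
  survival of \<open>F \<union> nsets e t\<close>. Conditionally on the prefix, the next block is
  uniform among \<open>K - i\<close> candidates, where \<open>K = card (nsets X k)\<close>.\<close>

lemma survival_Suc:
  assumes fin: "finite X" and i: "i < card (nsets X k)" and tk: "t \<le> k" and F: "F \<subseteq> nsets X t"
  shows "survival X k t (Suc i) F = survival X k t i F -
    (\<Sum>e\<in>{e\<in>nsets X k. nsets e t \<inter> F \<noteq> {}}. survival X k t i (F \<union> nsets e t)) / (real (card (nsets X k)) - real i)"
proof -
  define E where "E = nsets X k"
  define U where "U i F = {xs\<in>permutations_of_set E. uncovered_all t (take i xs) F}" for i F
  define Z where "Z e = {xs\<in>permutations_of_set E. uncovered_all t (take i xs) (F \<union> nsets e t) \<and> xs ! i = e}" for e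
  let ?M = "{e\<in>E. nsets e t \<inter> F \<noteq> {}}"
  have finE: "finite E" unfolding E_def using fin by (rule finite_imp_finite_nsets)
  have finU: "finite (U i F)" for i F
    unfolding U_def by (rule finite_subset[OF _ finite_permutations_of_set[of E]]) (rule Collect_restrict)
  have finZ: "finite (Z e)" for e
    unfolding Z_def by (rule finite_subset[OF _ finite_permutations_of_set[of E]]) (rule Collect_restrict)
  have ne: "nsets e t \<noteq> {}" if "e \<in> E" for e
  proof -
    have "t \<le> card e" using that tk by (simp add: E_def nsets_def)
    then obtain T where "T \<subseteq> e" "card T = t" "finite T" by (rule obtain_subset_with_card_n)
    then show ?thesis by (auto simp: nsets_def)
  qed
  have xsi: "xs ! i \<in> E" "take (Suc i) xs = take i xs @ [xs ! i]" "set xs = E" "length xs = card E"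
    if "xs \<in> permutations_of_set E" for xs
  proof -
    show "length xs = card E" using that by (rule length_finite_permutations_of_set)
    then show "take (Suc i) xs = take i xs @ [xs ! i]" using i by (simp add: take_Suc_conv_app_nth E_def)
    show "set xs = E" using that by (simp add: permutations_of_set_def)
    then show "xs ! i \<in> E" using \<open>length xs = card E\<close> i nth_mem[of i xs] unfolding E_def by argo
  qed
  have step: "uncovered_all t (take (Suc i) xs) F \<longleftrightarrow> uncovered_all t (take i xs) F \<and>
      \<not> (uncovered_all t (take i xs) (nsets (xs ! i) t) \<and> nsets (xs ! i) t \<inter> F \<noteq> {})"
    if "xs \<in> permutations_of_set E" for xs
  proof -
    let ?C = "greedy t (take i xs)"
    have *: "T \<subseteq> xs ! i \<longleftrightarrow> T \<in> nsets (xs ! i) t" if "T \<in> F" for T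
      using that F by (auto simp: nsets_def)
    have "uncovered_all t (take (Suc i) xs) F \<longleftrightarrow> uncovered_all t (take i xs) F \<and>
        \<not> (admissible t ?C (xs ! i) \<and> (\<exists>T\<in>F. T \<subseteq> xs ! i))"
      unfolding xsi(2)[OF that] uncovered_all_def greedy_snoc covered_def
      by (cases "admissible t ?C (xs ! i)") (simp_all, blast)
    also have "(\<exists>T\<in>F. T \<subseteq> xs ! i) \<longleftrightarrow> nsets (xs ! i) t \<inter> F \<noteq> {}"
      by (auto simp: *)
    finally show ?thesis unfolding admissible_iff_uncovered_all .
  qed
  have UZ: "xs \<in> U i F \<longleftrightarrow> xs \<in> permutations_of_set E \<and> uncovered_all t (take i xs) F" for xs i F
    by (simp add: U_def)
  have ZU: "xs \<in> Z e \<longleftrightarrow> xs \<in> permutations_of_set E \<and> uncovered_all t (take i xs) F \<and>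
       uncovered_all t (take i xs) (nsets e t) \<and> xs ! i = e" for xs e
    by (simp add: Z_def uncovered_all_Un conj_assoc)
  have split: "U i F = U (Suc i) F \<union> (\<Union>e\<in>?M. Z e)"
  proof (rule set_eqI)
    fix xs
    show "xs \<in> U i F \<longleftrightarrow> xs \<in> U (Suc i) F \<union> (\<Union>e\<in>?M. Z e)"
    proof (cases "xs \<in> permutations_of_set E")
      case True
      then have "xs ! i \<in> E" by (rule xsi(1))
      then show ?thesis
        using step[OF True] by (simp add: UZ ZU True) blast
    qed (simp add: UZ ZU)
  qed
  have disj: "U (Suc i) F \<inter> (\<Union>e\<in>?M. Z e) = {}"
  proof -
    have "xs \<notin> Z e" if xs: "xs \<in> U (Suc i) F" and e: "e \<in> ?M" for xs e
    proof
      assume Z: "xs \<in> Z e"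
      then have "xs \<in> permutations_of_set E" by (simp add: ZU)
      from step[OF this] xs e Z show False by (simp add: UZ ZU)
    qed
    then show ?thesis by blast
  qed
  have "card (U i F) = card (U (Suc i) F) + card (\<Union>e\<in>?M. Z e)"
    unfolding split using finU finE finZ disj by (intro card_Un_disjoint finite_UN_I) simp_all
  also have "card (\<Union>e\<in>?M. Z e) = (\<Sum>e\<in>?M. card (Z e))"
  proof (rule card_UN_disjoint)
    show "\<forall>a\<in>?M. \<forall>b\<in>?M. a \<noteq> b \<longrightarrow> Z a \<inter> Z b = {}" by (simp add: disjoint_iff ZU)
  qed (simp_all add: finE finZ)
  finally have main: "card (U i F) = card (U (Suc i) F) + (\<Sum>e\<in>?M. card (Z e))" .
  have Z: "real (card (Z e)) = real (card (U i (F \<union> nsets e t))) / (real (card E) - real i)" if "e \<in> E" for e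
  proof -
    have "(card E - i) * card (Z e) =
        card {xs\<in>permutations_of_set E. uncovered_all t (take i xs) (F \<union> nsets e t) \<and> e \<notin> set (take i xs)}"
      unfolding Z_def using i[folded E_def] that
      by (rule card_permutations_next[where P = "\<lambda>ys. uncovered_all t ys (F \<union> nsets e t)"])
    \<comment> \<open>The condition that \<open>e\<close> has not been read yet is automatic: a
      block that has been read contains a covered \<open>t\<close>-set.\<close>
    also have "{xs\<in>permutations_of_set E. uncovered_all t (take i xs) (F \<union> nsets e t) \<and> e \<notin> set (take i xs)} = U i (F \<union> nsets e t)"
      using not_admissible_greedy[OF _ ne[OF that]]
      unfolding U_def uncovered_all_Un admissible_iff_uncovered_all by blast
    finally have "(real (card E) - real i) * real (card (Z e)) = real (card (U i (F \<union> nsets e t)))"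
      using i by (metis E_def less_imp_le_nat of_nat_diff of_nat_mult)
    then show ?thesis using i by (simp add: E_def field_simps)
  qed
  have "real (card (U (Suc i) F)) = real (card (U i F)) -
      (\<Sum>e\<in>?M. real (card (U i (F \<union> nsets e t)))) / (real (card E) - real i)"
    using main Z by (simp add: sum_divide_distrib)
  then show ?thesis
    unfolding survival_altdef[OF fin] E_def[symmetric] U_def[symmetric]
    by (simp add: diff_divide_distrib sum_divide_distrib mult.commute)
qed

section \<open>Counting blocks through given \<open>t\<close>-sets\<close>

lemma card_nsets_superset:
  assumes "finite X" "A \<subseteq> X" "card A \<le> k"
  shows "card {B\<in>nsets X k. A \<subseteq> B} = (card X - card A) choose (k - card A)"
proof -
  have finA: "finite A" using assms finite_subset by blast
  have "bij_betw (\<lambda>B. B - A) {B\<in>nsets X k. A \<subseteq> B} (nsets (X - A) (k - card A))"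
  proof (rule bij_betw_byWitness[where f' = "\<lambda>C. C \<union> A"])
    show "(\<lambda>B. B - A) ` {B\<in>nsets X k. A \<subseteq> B} \<subseteq> nsets (X - A) (k - card A)"
      using finA by (auto simp: nsets_def card_Diff_subset)
    have "C \<union> A \<in> {B\<in>nsets X k. A \<subseteq> B}" if "C \<in> nsets (X - A) (k - card A)" for C
    proof -
      have "C \<inter> A = {}" "finite C" "C \<subseteq> X" "card C = k - card A" using that by (auto simp: nsets_def)
      then show ?thesis using assms finA by (simp add: nsets_def card_Un_disjoint)
    qed
    then show "(\<lambda>C. C \<union> A) ` nsets (X - A) (k - card A) \<subseteq> {B\<in>nsets X k. A \<subseteq> B}" by blast
  qed (auto simp: nsets_def)
  then have "card {B\<in>nsets X k. A \<subseteq> B} = card (nsets (X - A) (k - card A))"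
    by (rule bij_betw_same_card)
  then show ?thesis using assms finA by (simp add: card_Diff_subset)
qed

text \<open>A block containing both sets contains \<open>T\<close> and a point of \<open>T'\<close>
  outside \<open>T\<close>, hence \<open>t + 1\<close> prescribed points.\<close>

lemma card_nsets_superset_two_le:
  assumes "finite X" "t < k" "T \<in> nsets X t" "T' \<in> nsets X t" "T \<noteq> T'"
  shows "card {B\<in>nsets X k. T \<subseteq> B \<and> T' \<subseteq> B} \<le> (card X - t - 1) choose (k - t - 1)"
proof -
  have T: "finite T" "finite T'" "card T = t" "card T' = t" "T \<subseteq> X" "T' \<subseteq> X"
    using assms by (auto simp: nsets_def)
  then have "\<not> T' \<subseteq> T" using assms(5) card_subset_eq by metis
  then obtain x where x: "x \<in> T'" "x \<notin> T" by blast
  have "card {B\<in>nsets X k. T \<subseteq> B \<and> T' \<subseteq> B} \<le> card {B\<in>nsets X k. insert x T \<subseteq> B}"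
    using finite_imp_finite_nsets[OF assms(1), of k] x by (intro card_mono) auto
  also have "\<dots> = (card X - card (insert x T)) choose (k - card (insert x T))"
    using T x assms by (intro card_nsets_superset) auto
  finally show ?thesis using T x by simp
qed

lemma sum_card_Int_eq:
  assumes "finite S" "finite F"
  shows "(\<Sum>e\<in>S. card (f e \<inter> F)) = (\<Sum>T\<in>F. card {e\<in>S. T \<in> f e})"
proof -
  have "(\<Sum>e\<in>S. card (f e \<inter> F)) = (\<Sum>e\<in>S. \<Sum>T\<in>F. if T \<in> f e then 1 else 0)"
    using assms by (intro sum.cong refl) (simp add: sum.If_cases Int_commute Int_def)
  also have "\<dots> = (\<Sum>T\<in>F. \<Sum>e\<in>S. if T \<in> f e then 1 else 0)" by (rule sum.swap)
  also have "\<dots> = (\<Sum>T\<in>F. card {e\<in>S. T \<in> f e})"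
    using assms by (intro sum.cong refl) (simp add: sum.If_cases Int_def)
  finally show ?thesis .
qed

lemma nsets_mem_iff_subset: "T \<in> nsets X t \<Longrightarrow> T \<in> nsets e t \<longleftrightarrow> T \<subseteq> e"
  by (auto simp: nsets_def)

text \<open>Almost all blocks that meet \<open>F\<close> meet it in a single \<open>t\<close>-set.\<close>

lemma sum_meeting_blocks:
  fixes w :: "'a set \<Rightarrow> real" and g \<delta> :: real
  defines "D \<equiv> \<lambda>X k t. real ((card X - t) choose (k - t))"
  assumes X: "finite X" and tk: "t < k" and F: "F \<subseteq> nsets X t"
    and w: "\<And>e. 0 \<le> w e" "\<And>e. w e \<le> 1" and g: "0 \<le> g" "g \<le> 1"
    and close: "\<And>e. e \<in> nsets X k \<Longrightarrow> card (nsets e t \<inter> F) = 1 \<Longrightarrow> \<bar>w e - g\<bar> \<le> \<delta>" and \<delta>: "0 \<le> \<delta>"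
  shows "(\<Sum>e\<in>{e\<in>nsets X k. nsets e t \<inter> F \<noteq> {}}. w e) \<le> real (card F) * D X k t"
    and "\<bar>(\<Sum>e\<in>{e\<in>nsets X k. nsets e t \<inter> F \<noteq> {}}. w e) - real (card F) * D X k t * g\<bar>
      \<le> real (card F) * D X k t * \<delta> + real (card F) ^ 2 * D X k (Suc t)"
proof -
  let ?m = "real (card F)"
  define E where "E = nsets X k"
  define c where "c e = card (nsets e t \<inter> F)" for e
  define M where "M = {e\<in>E. nsets e t \<inter> F \<noteq> {}}"
  define E1 where "E1 = {e\<in>E. c e = 1}"
  define E2 where "E2 = {e\<in>E. 2 \<le> c e}"
  define W where "W = (\<Sum>e\<in>E2. c e)"
  have finE: "finite E" unfolding E_def using X by (rule finite_imp_finite_nsets)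
  have finF: "finite F" using F finite_imp_finite_nsets[OF X] finite_subset by blast
  have fin: "finite E1" "finite E2" unfolding E1_def E2_def using finE by simp_all
  have disj: "E1 \<inter> E2 = {}" unfolding E1_def E2_def by auto
  have M: "M = E1 \<union> E2"
  proof -
    have "nsets e t \<inter> F \<noteq> {} \<longleftrightarrow> c e = 1 \<or> 2 \<le> c e" for e
    proof -
      have "nsets e t \<inter> F = {} \<longleftrightarrow> c e = 0" unfolding c_def using finF by simp
      then show ?thesis by linarith
    qed
    then show ?thesis unfolding M_def E1_def E2_def by blast
  qed
  have deg: "card {e\<in>E. T \<in> nsets e t} = (card X - t) choose (k - t)" if "T \<in> F" for T
  proof -
    have T: "T \<in> nsets X t" using that F by blast
    then have "T \<subseteq> X" "card T = t" by (auto simp: nsets_def)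
    then show ?thesis
      unfolding E_def nsets_mem_iff_subset[OF T] using card_nsets_superset[OF X, of T k] tk by simp
  qed
  have "(\<Sum>e\<in>E. c e) = card F * ((card X - t) choose (k - t))"
    unfolding c_def sum_card_Int_eq[OF finE finF] using deg by simp
  moreover have "(\<Sum>e\<in>E. c e) = (\<Sum>e\<in>E1 \<union> E2. c e)"
  proof (rule sum.mono_neutral_right[OF finE])
    show "E1 \<union> E2 \<subseteq> E" unfolding E1_def E2_def by blast
    show "\<forall>e\<in>E - (E1 \<union> E2). c e = 0" unfolding E1_def E2_def by auto
  qed
  moreover have "\<dots> = card E1 + W"
    unfolding sum.union_disjoint[OF fin disj] W_def by (simp add: E1_def)
  ultimately have total: "real (card E1) + real W = ?m * D X k t"
    unfolding D_def of_nat_mult[symmetric] of_nat_add[symmetric] by presburger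
  have "card E2 * 2 \<le> W"
    unfolding W_def using sum_bounded_below[of E2 2 c] by (simp add: E2_def)
  then have cE2: "real (card E2) \<le> real W" by simp
  \<comment> \<open>Incidences are now counted from the side of \<open>F\<close>: a block of
    \<open>E2\<close> through \<open>T\<close> contains a second member \<open>T'\<close> of
    \<open>F\<close>, and the codegree bounds the number of blocks through both.\<close>
  have "W = (\<Sum>T\<in>F. card {e\<in>E2. T \<in> nsets e t})"
    unfolding W_def c_def by (rule sum_card_Int_eq[OF fin(2) finF])
  also have "\<dots> \<le> (\<Sum>T\<in>F. card F * ((card X - t - 1) choose (k - t - 1)))"
  proof (rule sum_mono)
    fix T assume T: "T \<in> F"
    have sub: "{e\<in>E2. T \<in> nsets e t} \<subseteq> (\<Union>T'\<in>F - {T}. {e\<in>E. T \<subseteq> e \<and> T' \<subseteq> e})"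
    proof
      fix e assume e: "e \<in> {e\<in>E2. T \<in> nsets e t}"
      then have "2 \<le> card (nsets e t \<inter> F)" by (simp add: E2_def c_def)
      then have "\<not> nsets e t \<inter> F \<subseteq> {T}" using card_mono[of "{T}" "nsets e t \<inter> F"] by auto
      then obtain T' where T': "T' \<in> nsets e t" "T' \<in> F - {T}" by blast
      have "T \<subseteq> e" "T' \<subseteq> e" "e \<in> E" using e T'(1) by (auto simp: nsets_def E2_def)
      then show "e \<in> (\<Union>T'\<in>F - {T}. {e\<in>E. T \<subseteq> e \<and> T' \<subseteq> e})" using T'(2) by blast
    qed
    have "card {e\<in>E2. T \<in> nsets e t} \<le> card (\<Union>T'\<in>F - {T}. {e\<in>E. T \<subseteq> e \<and> T' \<subseteq> e})"
      by (rule card_mono[OF _ sub]) (simp add: finE finF)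
    also have "\<dots> \<le> (\<Sum>T'\<in>F - {T}. card {e\<in>E. T \<subseteq> e \<and> T' \<subseteq> e})"
      by (rule card_UN_le) (simp add: finF)
    also have "\<dots> \<le> (\<Sum>T'\<in>F - {T}. (card X - t - 1) choose (k - t - 1))"
      unfolding E_def using T F by (intro sum_mono card_nsets_superset_two_le[OF X tk]) auto
    also have "\<dots> \<le> card F * ((card X - t - 1) choose (k - t - 1))"
      using finF by (simp add: card_Diff1_le)
    finally show "card {e\<in>E2. T \<in> nsets e t} \<le> card F * ((card X - t - 1) choose (k - t - 1))" .
  qed
  finally have "real W \<le> real (card F * (card F * ((card X - t - 1) choose (k - t - 1))))"
    by (simp only: of_nat_le_iff sum_constant of_nat_id)
  then have W: "real W \<le> ?m ^ 2 * D X k (Suc t)" by (simp add: D_def power2_eq_square)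
  have sumM: "(\<Sum>e\<in>M. w e) = (\<Sum>e\<in>E1. w e) + (\<Sum>e\<in>E2. w e)"
    unfolding M using fin disj by (rule sum.union_disjoint)
  have s2: "0 \<le> (\<Sum>e\<in>E2. w e)" "(\<Sum>e\<in>E2. w e) \<le> real (card E2)"
    using w sum_bounded_above[of E2 w 1] by (auto intro: sum_nonneg)
  have s1: "(\<Sum>e\<in>E1. w e) \<le> real (card E1)"
    using w sum_bounded_above[of E1 w 1] by simp
  show "(\<Sum>e\<in>{e\<in>nsets X k. nsets e t \<inter> F \<noteq> {}}. w e) \<le> ?m * D X k t"
    unfolding E_def[symmetric] M_def[symmetric] using sumM s2 s1 cE2 total by linarith
  have "\<bar>(\<Sum>e\<in>E1. w e) - real (card E1) * g\<bar> = \<bar>\<Sum>e\<in>E1. (w e - g)\<bar>"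
    by (simp add: sum_subtractf)
  also have "\<dots> \<le> (\<Sum>e\<in>E1. \<bar>w e - g\<bar>)" by (rule sum_abs)
  also have "\<dots> \<le> real (card E1) * \<delta>"
    using close by (intro sum_bounded_above) (simp add: E1_def E_def c_def)
  also have "\<dots> \<le> ?m * D X k t * \<delta>"
    using total \<delta> by (intro mult_right_mono) simp_all
  finally have a: "\<bar>(\<Sum>e\<in>E1. w e) - real (card E1) * g\<bar> \<le> ?m * D X k t * \<delta>" .
  \<comment> \<open>The part of the main term belonging to \<open>E2\<close> is
    \<open>W * g\<close>. It lies in the interval from 0 to \<open>W\<close>, as does the sum of
    \<open>w\<close> over \<open>E2\<close>, so the two differ by at most \<open>W\<close>.\<close>
  have "?m * D X k t * g = real (card E1) * g + real W * g"
    unfolding total[symmetric] by (simp add: algebra_simps)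
  moreover have "0 \<le> real W * g" "real W * g \<le> real W" using g by (simp_all add: mult_left_le)
  ultimately show "\<bar>(\<Sum>e\<in>{e\<in>nsets X k. nsets e t \<inter> F \<noteq> {}}. w e) - ?m * D X k t * g\<bar>
      \<le> ?m * D X k t * \<delta> + ?m ^ 2 * D X k (Suc t)"
    unfolding E_def[symmetric] M_def[symmetric] sumM using a s2 cE2 W by linarith
qed

subsection \<open>Convergence of the survival probabilities\<close>

lemma choose_gt_1:
  assumes "0 < t" "t < k"
  shows "1 < k choose t"
proof -
  have "k \<le> k choose t" using assms by (intro upper_le_binomial) auto
  then show ?thesis using assms by linarith
qed

section \<open>The limiting solution of the hierarchy\<close>

definition ref_survival :: "real \<Rightarrow> real \<Rightarrow> real \<Rightarrow> real" where
  "ref_survival q m x = (1 + q * x) powr (- (m / q))"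

lemma ref_survival_bounds:
  assumes "0 < q" "0 \<le> m" "0 \<le> x"
  shows "0 \<le> ref_survival q m x" "ref_survival q m x \<le> 1"
proof -
  show "0 \<le> ref_survival q m x" by (simp add: ref_survival_def)
  have "(1 + q * x) powr (- (m / q)) \<le> (1 + q * x) powr 0"
    using assms by (intro powr_mono) auto
  then show "ref_survival q m x \<le> 1"
    using assms by (simp add: ref_survival_def add_nonneg_eq_0_iff split: if_splits)
qed

lemma ref_survival_0 [simp]: "ref_survival q m 0 = 1"
  by (simp add: ref_survival_def)

lemma DERIV_ref_survival:
  assumes "0 < q" "0 \<le> x"
  shows "(ref_survival q m has_real_derivative - m * ref_survival q (m + q) x) (at x)"
proof -
  have pos: "0 < 1 + q * x" using assms by (simp add: add_pos_nonneg)
  have "((\<lambda>x. (1 + q * x) powr (- (m / q))) has_real_derivative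
      - (m / q) * (1 + q * x) powr (- (m / q) - 1) * q) (at x)"
    using pos by (auto intro!: derivative_eq_intros)
  moreover have "- (m / q) - 1 = - ((m + q) / q)" using assms by (simp add: field_simps)
  moreover have "- (m / q) * (1 + q * x) powr (- ((m + q) / q)) * q = - m * ref_survival q (m + q) x"
    using assms by (simp add: ref_survival_def)
  ultimately show ?thesis unfolding ref_survival_def[abs_def] by simp
qed

text \<open>The error of an Euler step. The second derivative is \<open>m * (m + q)\<close> times a
  value of \<open>ref_survival\<close>, which is at most 1; applying the mean value theorem twice
  gives the bound without the factor 1/2.\<close>

lemma ref_survival_step:
  assumes q: "0 < q" and m: "0 \<le> m" and x: "0 \<le> x" and h: "0 < h"
  shows "\<bar>ref_survival q m (x + h) - ref_survival q m x + m * h * ref_survival q (m + q) x\<bar>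
    \<le> m * (m + q) * h ^ 2"
proof -
  have "\<exists>z>x. z < x + h \<and> ref_survival q m (x + h) - ref_survival q m x =
      (x + h - x) * (- m * ref_survival q (m + q) z)"
    using h x by (intro MVT2 DERIV_ref_survival q) auto
  then obtain z where z: "x < z" "z < x + h"
    "ref_survival q m (x + h) - ref_survival q m x = h * (- m * ref_survival q (m + q) z)" by auto
  have "\<exists>y>x. y < z \<and> ref_survival q (m + q) z - ref_survival q (m + q) x =
      (z - x) * (- (m + q) * ref_survival q (m + q + q) y)"
    using z x by (intro MVT2 DERIV_ref_survival q) auto
  then obtain y where y: "x < y" "y < z"
    "ref_survival q (m + q) z - ref_survival q (m + q) x = (z - x) * (- (m + q) * ref_survival q (m + q + q) y)"
    by auto
  have g: "0 \<le> ref_survival q (m + q + q) y" "ref_survival q (m + q + q) y \<le> 1"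
    using q m x y by (auto intro!: ref_survival_bounds)
  have "ref_survival q m (x + h) - ref_survival q m x + m * h * ref_survival q (m + q) x
      = - m * h * (ref_survival q (m + q) z - ref_survival q (m + q) x)"
    unfolding z(3) by (simp add: algebra_simps)
  also have "\<dots> = m * h * ((z - x) * ((m + q) * ref_survival q (m + q + q) y))"
    unfolding y(3) by (simp add: algebra_simps)
  finally have eq: "ref_survival q m (x + h) - ref_survival q m x + m * h * ref_survival q (m + q) x
      = m * h * ((z - x) * ((m + q) * ref_survival q (m + q + q) y))" .
  have "(z - x) * ((m + q) * ref_survival q (m + q + q) y) \<le> h * ((m + q) * 1)"
    using z g m q by (intro mult_mono mult_nonneg_nonneg) auto
  then have "m * h * ((z - x) * ((m + q) * ref_survival q (m + q + q) y)) \<le> m * h * (h * ((m + q) * 1))"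
    using m h by (intro mult_left_mono) auto
  moreover have "0 \<le> m * h * ((z - x) * ((m + q) * ref_survival q (m + q + q) y))"
    using m h z g q by (intro mult_nonneg_nonneg) auto
  ultimately show ?thesis unfolding eq by (simp add: power2_eq_square algebra_simps)
qed

lemma ref_survival_tendsto_0:
  assumes "0 < q" "0 < m"
  shows "(ref_survival q m \<longlongrightarrow> 0) at_top"
proof -
  have "filterlim (\<lambda>x. 1 + q * x) at_top at_top"
    using assms by (intro filterlim_tendsto_add_at_top[OF tendsto_const]
      filterlim_tendsto_pos_mult_at_top[OF tendsto_const]) (auto simp: filterlim_ident)
  then show ?thesis
    unfolding ref_survival_def[abs_def] using assms by (intro tendsto_neg_powr) auto
qed

text \<open>The unit of time: the probability that a random block contains a given \<open>t\<close>-set.\<close>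

definition step_length :: "nat \<Rightarrow> nat \<Rightarrow> nat \<Rightarrow> real" where
  "step_length k t n = real (k choose t) / real (n choose t)"

text \<open>Error of one step per unit of time. The summands account for blocks containing several
  members of the family, for replacing the number \<open>K - i\<close> of remaining blocks by
  \<open>K\<close>, and for the Euler step.\<close>

definition step_error :: "nat \<Rightarrow> nat \<Rightarrow> real \<Rightarrow> real \<Rightarrow> nat \<Rightarrow> real" where
  "step_error k t c m n =
     m\<^sup>2 * (real ((n - Suc t) choose (k - Suc t)) / real ((n - t) choose (k - t))) +
     2 * c * m / real ((n - t) choose (k - t)) +
     m * (m + (real (k choose t) - 1)) * step_length k t n"

text \<open>The recursion \<open>survival_Suc\<close> is compared with an Euler step of
  \<open>ref_survival\<close>. A block meeting \<open>F\<close> in one set enlarges it by exactly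
  \<open>q\<close> sets, so an error \<open>b\<close> for families of that larger size enters with
  weight \<open>card F * h\<close>.\<close>

lemma survival_step:
  fixes X :: "'a set" and k t i :: nat and c a b :: real
  defines "n \<equiv> card X" and "q \<equiv> (k choose t) - 1"
  defines "h \<equiv> step_length k t n"
  assumes X: "finite X" and t: "0 < t" "t < k" and k: "k \<le> n"
    and F: "F \<subseteq> nsets X t" and i: "real i * h \<le> c" and c: "2 * c \<le> real ((n - t) choose (k - t))"
    and a: "\<bar>survival X k t i F - ref_survival (real q) (real (card F)) (real i * h)\<bar> \<le> a"
    and b: "0 \<le> b" "\<And>F'. F' \<subseteq> nsets X t \<Longrightarrow> card F' = card F + q \<Longrightarrow>
       \<bar>survival X k t i F' - ref_survival (real q) (real (card F')) (real i * h)\<bar> \<le> b"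
  shows "\<bar>survival X k t (Suc i) F - ref_survival (real q) (real (card F)) (real (Suc i) * h)\<bar>
     \<le> a + real (card F) * h * b + h * step_error k t c (real (card F)) n"
proof -
  let ?m = "real (card F)"
  define K where "K = real (n choose k)"
  define D where "D = real ((n - t) choose (k - t))"
  define D2 where "D2 = real ((n - Suc t) choose (k - Suc t))"
  define S where "S = (\<Sum>e\<in>{e\<in>nsets X k. nsets e t \<inter> F \<noteq> {}}. survival X k t i (F \<union> nsets e t))"
  define g where "g = ref_survival (real q) (?m + real q) (real i * h)"
  have finF: "finite F" using F finite_imp_finite_nsets[OF X] finite_subset by blast
  have q: "0 < q" "k choose t = Suc q" using choose_gt_1[OF t] unfolding q_def by auto
  have K: "0 < K" and D: "0 < D" and N: "0 < real (n choose t)"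
    using k t unfolding K_def D_def by simp_all
  have h: "0 < h" unfolding h_def step_length_def using q N by (simp add: q)
  \<comment> \<open>Double counting pairs of a block and a \<open>t\<close>-set in it identifies the
    time unit with the fraction of blocks through a fixed \<open>t\<close>-set.\<close>
  have hDK: "h = D / K"
  proof -
    have "(n choose k) * (k choose t) = (n choose t) * ((n - t) choose (k - t))"
      using k t by (intro choose_mult) auto
    then have "K * real (k choose t) = real (n choose t) * D"
      unfolding K_def D_def of_nat_mult[symmetric] by simp
    then show ?thesis unfolding h_def step_length_def using K N by (simp add: field_simps)
  qed
  have c0: "0 \<le> c" using i h by (smt (verit) mult_nonneg_nonneg of_nat_0_le_iff)
  have iK: "real i * D \<le> c * K" using i K unfolding hDK by (simp add: field_simps)
  \<comment> \<open>The time bound reads \<open>i * D \<le> c * K\<close>. With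
    \<open>2 * c \<le> D\<close> at most half of the blocks have been read, which keeps
    \<open>K - i\<close> at least \<open>K / 2\<close> below.\<close>
  have "2 * c * K \<le> D * K" using c K unfolding D_def by (intro mult_right_mono) auto
  then have "D * (2 * real i) \<le> D * K" using iK by (simp add: algebra_simps)
  then have i2: "2 * real i \<le> K" using D by simp
  have ilt: "i < card (nsets X k)"
  proof -
    have "real i < K" using i2 K by linarith
    then show ?thesis unfolding K_def by (simp add: n_def)
  qed
  have g01: "0 \<le> g" "g \<le> 1"
    unfolding g_def using q h by (auto intro!: ref_survival_bounds)
  have close: "\<bar>survival X k t i (F \<union> nsets e t) - g\<bar> \<le> b"
    if e: "e \<in> nsets X k" "card (nsets e t \<inter> F) = 1" for e
  proof -
    have "e \<subseteq> X" "card e = k" "finite e" using e(1) by (auto simp: nsets_def)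
    then have sub: "F \<union> nsets e t \<subseteq> nsets X t" using F nsets_mono[of e X t] by blast
    have "card (F \<union> nsets e t) + card (F \<inter> nsets e t) = card F + card (nsets e t)"
      using card_Un_Int[of F "nsets e t"] finF finite_imp_finite_nsets[OF \<open>finite e\<close>] by simp
    then have cd: "card (F \<union> nsets e t) = card F + q"
      using e(2) \<open>card e = k\<close> q by (simp add: Int_commute)
    show ?thesis using b(2)[OF sub cd] unfolding g_def cd by simp
  qed
  have S: "S \<le> ?m * D" "\<bar>S - ?m * D * g\<bar> \<le> ?m * D * b + ?m ^ 2 * D2"
    unfolding S_def D_def D2_def n_def
    using sum_meeting_blocks[OF X t(2) F, where w = "\<lambda>e. survival X k t i (F \<union> nsets e t)" and g = g and \<delta> = b]
      survival_bounds g01 close b(1) by blast+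
  have S0: "0 \<le> S" unfolding S_def by (intro sum_nonneg survival_bounds)
  \<comment> \<open>\<open>A\<close> replaces the denominator \<open>K - i\<close> by
    \<open>K\<close>, \<open>B\<close> replaces \<open>S\<close> by its main term, and
    \<open>C\<close> is the Euler error. Apart from the term with \<open>b\<close>, they yield the
    three summands of \<open>step_error\<close>.\<close>
  have A: "\<bar>S / (K - real i) - S / K\<bar> \<le> h * (2 * c * ?m / D)"
  proof -
    have Ki: "K / 2 \<le> K - real i" "0 < K - real i" using i2 K by linarith+
    have "S / (K - real i) - S / K = S * real i / (K * (K - real i))"
      using Ki K by (simp add: field_simps)
    moreover have "0 \<le> S * real i / (K * (K - real i))" using S0 K Ki by simp
    moreover have "S * real i / (K * (K - real i)) \<le> (?m * D * real i) / (K * (K / 2))"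
      using S(1) S0 K Ki D by (intro frac_le mult_right_mono mult_left_mono mult_nonneg_nonneg) auto
    moreover have "(?m * D * real i) / (K * (K / 2)) = 2 * ?m * (real i * D) / (K * K)"
      using K by (simp add: field_simps)
    moreover have "\<dots> \<le> 2 * ?m * (c * K) / (K * K)"
      using iK K by (intro divide_right_mono mult_left_mono) auto
    moreover have "\<dots> = h * (2 * c * ?m / D)" unfolding hDK using K D by (simp add: field_simps)
    ultimately show ?thesis by linarith
  qed
  have B: "\<bar>S / K - ?m * h * g\<bar> \<le> ?m * h * b + h * (?m ^ 2 * (D2 / D))"
  proof -
    have "S / K - ?m * h * g = (S - ?m * D * g) / K" unfolding hDK by (simp add: diff_divide_distrib)
    then have "\<bar>S / K - ?m * h * g\<bar> = \<bar>S - ?m * D * g\<bar> / K" using K by simp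
    also have "\<dots> \<le> (?m * D * b + ?m ^ 2 * D2) / K" using S(2) K by (intro divide_right_mono) auto
    also have "\<dots> = ?m * h * b + h * (?m ^ 2 * (D2 / D))"
      unfolding hDK using D K by (simp add: field_simps)
    finally show ?thesis .
  qed
  have C: "\<bar>ref_survival q ?m (real (Suc i) * h) - ref_survival q ?m (real i * h) + ?m * h * g\<bar>
      \<le> h * (?m * (?m + real q) * h)"
    using ref_survival_step[of "real q" ?m "real i * h" h] q h
    unfolding g_def by (simp add: algebra_simps power2_eq_square)
  have E: "survival X k t (Suc i) F = survival X k t i F - S / (K - real i)"
    using survival_Suc[OF X ilt _ F] t unfolding S_def K_def n_def by simp
  have qr: "real (k choose t) - 1 = real q" using q by simp
  have T: "h * step_error k t c ?m n = h * (?m ^ 2 * (D2 / D)) + h * (2 * c * ?m / D) + h * (?m * (?m + real q) * h)"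
    unfolding step_error_def D_def D2_def h_def qr by (simp add: algebra_simps)
  show ?thesis unfolding E T using a A B C by (simp add: abs_le_iff)
qed

section \<open>Asymptotics of the degrees and of the one-step error\<close>

lemma filterlim_binomial_at_top:
  assumes "0 < j"
  shows "filterlim (\<lambda>n. real (n choose j)) at_top sequentially"
proof (rule filterlim_at_top_mono)
  show "filterlim (\<lambda>n. real n / real j) at_top sequentially"
    using assms by real_asymp
  have "n \<le> j * (n choose j)" if "j \<le> n" for n
  proof -
    obtain i where i: "j = Suc i" using assms gr0_conv_Suc by blast
    have "1 \<le> (n - 1) choose i" using that i by (simp add: Suc_le_eq)
    then have "n * 1 \<le> n * ((n - 1) choose i)" by (rule mult_le_mono2)
    then show ?thesis using binomial_absorption[of i n] i by simp
  qed
  then have "real n / real j \<le> real (n choose j)" if "j \<le> n" for n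
    using that assms by (simp add: divide_le_eq mult.commute flip: of_nat_mult)
  then show "\<forall>\<^sub>F n in sequentially. real n / real j \<le> real (n choose j)"
    unfolding eventually_sequentially by blast
qed

lemma filterlim_binomial_degree:
  assumes "t < k"
  shows "filterlim (\<lambda>n. real ((n - t) choose (k - t))) at_top sequentially"
  using filterlim_compose[OF filterlim_binomial_at_top filterlim_minus_const_nat_at_top] assms by simp

lemma step_length_tendsto_0:
  assumes "0 < t"
  shows "(\<lambda>n. step_length k t n) \<longlonglongrightarrow> 0"
  unfolding step_length_def by (intro tendsto_divide_0[OF tendsto_const]
    filterlim_at_top_imp_at_infinity filterlim_binomial_at_top assms)

lemma codegree_ratio_tendsto_0:
  assumes "t < k"
  shows "(\<lambda>n. real ((n - Suc t) choose (k - Suc t)) / real ((n - t) choose (k - t))) \<longlonglongrightarrow> 0"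
proof (rule Lim_transform_eventually)
  show "(\<lambda>n. real (k - t) / (real n - real t)) \<longlonglongrightarrow> 0" by real_asymp
  have "real (k - t) / (real n - real t) = real ((n - Suc t) choose (k - Suc t)) / real ((n - t) choose (k - t))"
    if n: "k \<le> n" for n
  proof -
    obtain j where j: "k - t = Suc j" using assms by (metis Suc_diff_Suc)
    then have "k - Suc t = j" by simp
    have "Suc j * ((n - t) choose Suc j) = (n - t) * ((n - t - 1) choose j)"
      by (rule binomial_absorption)
    then have "real (Suc j * ((n - t) choose Suc j)) = real ((n - t) * ((n - Suc t) choose j))"
      by simp
    moreover have "real (n - t) = real n - real t" using n assms by simp
    ultimately have "real (Suc j) * real ((n - t) choose Suc j) = (real n - real t) * real ((n - Suc t) choose j)"
      unfolding of_nat_mult by simp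
    moreover have "0 < real ((n - t) choose Suc j)" using n assms j by simp
    ultimately show ?thesis using n assms j \<open>k - Suc t = j\<close> by (simp add: field_simps)
  qed
  then show "\<forall>\<^sub>F n in sequentially. real (k - t) / (real n - real t) =
      real ((n - Suc t) choose (k - Suc t)) / real ((n - t) choose (k - t))"
    unfolding eventually_sequentially by blast
qed

lemma step_error_tendsto_0:
  assumes "0 < t" "t < k"
  shows "(\<lambda>n. step_error k t c m n) \<longlonglongrightarrow> 0"
proof -
  have "(\<lambda>n. 2 * c * m / real ((n - t) choose (k - t))) \<longlonglongrightarrow> 0"
    by (intro tendsto_divide_0[OF tendsto_const] filterlim_at_top_imp_at_infinity
      filterlim_binomial_degree assms)
  then have "(\<lambda>n. step_error k t c m n) \<longlonglongrightarrow> m\<^sup>2 * 0 + 0 + m * (m + (real (k choose t) - 1)) * 0"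
    unfolding step_error_def
    by (intro tendsto_add tendsto_mult[OF tendsto_const] codegree_ratio_tendsto_0 step_length_tendsto_0 assms)
  then show ?thesis by simp
qed

section \<open>Propagation of the limit to arbitrary times\<close>

definition survival_close :: "nat \<Rightarrow> nat \<Rightarrow> nat \<Rightarrow> real \<Rightarrow> nat \<Rightarrow> nat \<Rightarrow> bool" where
  "survival_close k t m \<epsilon> n i \<longleftrightarrow> (\<forall>F\<subseteq>nsets {..<n} t. card F = m \<longrightarrow>
     \<bar>survival {..<n} k t i F - ref_survival (real ((k choose t) - 1)) (real m) (real i * step_length k t n)\<bar> \<le> \<epsilon>)"

lemma survival_close_mono: "survival_close k t m \<epsilon> n i \<Longrightarrow> \<epsilon> \<le> \<epsilon>' \<Longrightarrow> survival_close k t m \<epsilon>' n i"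
  unfolding survival_close_def by (auto intro!: order_trans[of _ \<epsilon> \<epsilon>'])

text \<open>Uniform over all steps up to time \<open>c\<close>, but not in \<open>m\<close>: each
  iteration of the hierarchy raises \<open>m\<close> only by a fixed amount, so finitely many sizes
  matter at a time.\<close>

definition survival_limit :: "nat \<Rightarrow> nat \<Rightarrow> real \<Rightarrow> bool" where
  "survival_limit k t c \<longleftrightarrow> (\<forall>m. \<forall>\<epsilon>>0. \<forall>\<^sub>F n in sequentially.
     \<forall>i. real i * step_length k t n \<le> c \<longrightarrow> survival_close k t m \<epsilon> n i)"

text \<open>The coefficients of the Taylor expansion \<open>(1 + q x) powr (- m / q)\<close> in absolute value.\<close>

definition taylor_coeff :: "real \<Rightarrow> real \<Rightarrow> nat \<Rightarrow> real" where
  "taylor_coeff q m J = (\<Prod>l<J. m + real l * q) / fact J"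

lemma taylor_coeff_nonneg: "0 \<le> q \<Longrightarrow> 0 \<le> m \<Longrightarrow> 0 \<le> taylor_coeff q m J"
  unfolding taylor_coeff_def by (intro divide_nonneg_pos prod_nonneg) auto

text \<open>Makes the iteration close up: \<open>m\<close> times the order \<open>J\<close> bound
  for size \<open>m + q\<close>, integrated in time, is the order \<open>Suc J\<close> bound for
  size \<open>m\<close>.\<close>

lemma taylor_coeff_Suc: "m * taylor_coeff q (m + q) J = real (Suc J) * taylor_coeff q m (Suc J)"
proof -
  have "(\<Prod>l<Suc J. m + real l * q) = m * (\<Prod>l<J. m + q + real l * q)"
    by (simp add: prod.lessThan_Suc_shift algebra_simps del: prod.lessThan_Suc)
  moreover have "real (Suc J) * (y / fact (Suc J)) = y / fact J" for y :: real
    by (simp del: of_nat_Suc)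
  ultimately show ?thesis unfolding taylor_coeff_def by simp
qed

text \<open>The quotient of consecutive terms tends to \<open>q * x < 1\<close>. The midpoint
  \<open>r\<close> between this limit and 1 serves in the ratio test.\<close>

lemma taylor_remainder_tendsto_0:
  assumes q: "0 < q" and m: "0 \<le> m" and x: "0 \<le> x" "x * q < 1"
  shows "(\<lambda>J. taylor_coeff q m J * x ^ J) \<longlonglongrightarrow> 0"
proof -
  define r where "r = (1 + x * q) / 2"
  have "y < (1 + y) / 2" "(1 + y) / 2 < 1" if "y < 1" for y :: real using that by simp_all
  from this[OF x(2)] have r: "x * q < r" "r < 1" unfolding r_def .
  have "(\<lambda>J. (m + real J * q) * x / real (Suc J)) \<longlonglongrightarrow> q * x" by real_asymp
  then have "\<forall>\<^sub>F J in sequentially. (m + real J * q) * x / real (Suc J) < r"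
    by (rule order_tendstoD(2)) (use r in \<open>simp add: mult.commute[of q x]\<close>)
  then obtain N where N: "(m + real J * q) * x / real (Suc J) < r" if "N \<le> J" for J
    unfolding eventually_sequentially by blast
  have "summable (\<lambda>J. taylor_coeff q m J * x ^ J)"
  proof (rule summable_ratio_test[OF r(2)])
    fix J assume J: "N \<le> J"
    have nn: "0 \<le> taylor_coeff q m J * x ^ J" for J
      using taylor_coeff_nonneg[of q m J] q m x by simp
    have "taylor_coeff q m (Suc J) * x ^ Suc J =
        ((m + real J * q) * x / real (Suc J)) * (taylor_coeff q m J * x ^ J)"
      by (simp add: taylor_coeff_def field_simps)
    also have "\<dots> \<le> r * (taylor_coeff q m J * x ^ J)"
      using N[OF J] nn by (intro mult_right_mono) auto
    finally show "norm (taylor_coeff q m (Suc J) * x ^ Suc J) \<le> r * norm (taylor_coeff q m J * x ^ J)"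
      using nn[of J] nn[of "Suc J"] by simp
  qed
  then show ?thesis by (rule summable_LIMSEQ_zero)
qed

text \<open>A discrete form of integrating \<open>w ^ J\<close>: one step of length \<open>h\<close>
  adds no more than the increment of the antiderivative.\<close>

lemma power_Suc_add_le:
  fixes w h :: real
  assumes "0 \<le> w" "0 \<le> h"
  shows "w ^ Suc J + real (Suc J) * h * w ^ J \<le> (w + h) ^ Suc J"
proof (induction J)
  case (Suc J)
  have "w ^ Suc (Suc J) + real (Suc (Suc J)) * h * w ^ Suc J
      \<le> w * (w ^ Suc J + real (Suc J) * h * w ^ J) + h * w ^ Suc J"
    by (simp add: algebra_simps)
  also have "\<dots> \<le> w * (w + h) ^ Suc J + h * (w + h) ^ Suc J"
    using assms Suc by (intro add_mono mult_left_mono power_mono) auto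
  finally show ?case by (simp add: algebra_simps)
qed simp

text \<open>
  Iterating the hierarchy \<open>J\<close> times expresses the error at time \<open>i\<close> through the errors at an
  earlier time and a remainder of Taylor type.
\<close>

lemma survival_close_taylor:
  fixes c s :: real and k t :: nat
  defines "q \<equiv> (k choose t) - 1"
  assumes t: "0 < t" "t < k" and c: "0 \<le> c" and s: "0 < s" and lim: "survival_limit k t c"
    and e: "0 < \<epsilon>"
  shows "\<forall>\<^sub>F n in sequentially. \<forall>i. real i * step_length k t n \<le> c + s \<longrightarrow>
    survival_close k t m (\<epsilon> + taylor_coeff (real q) (real m) J *
      (step_length k t n * real (i - nat \<lfloor>c / step_length k t n\<rfloor>)) ^ J) n i"
  using e
proof (induction J arbitrary: m \<epsilon>)
  case 0
  have q: "0 < real q" using choose_gt_1[OF t] by (simp add: q_def)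
  \<comment> \<open>For order 0 the Taylor term equals 1, and two numbers between 0 and 1 differ by
    at most 1.\<close>
  have "survival_close k t m (\<epsilon> + taylor_coeff (real q) (real m) 0 *
      (step_length k t n * real (i - nat \<lfloor>c / step_length k t n\<rfloor>)) ^ 0) n i" for n i
  proof -
    have "0 \<le> real i * step_length k t n" by (simp add: step_length_def)
    then have "\<bar>survival {..<n} k t i F - ref_survival (real q) (real m) (real i * step_length k t n)\<bar> \<le> 1" for F
      using survival_bounds[of "{..<n}" k t i F]
        ref_survival_bounds[OF q, of "real m" "real i * step_length k t n"] by (simp add: abs_le_iff)
    then have "survival_close k t m 1 n i" unfolding survival_close_def q_def by blast
    then show ?thesis by (rule survival_close_mono) (use 0 in \<open>simp add: taylor_coeff_def\<close>)
  qed
  then show ?case by simp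
next
  case (Suc J)
  have q: "0 < real q" using choose_gt_1[OF t] by (simp add: q_def)
  \<comment> \<open>The error budget: half of \<epsilon> for the error up to time \<open>c\<close>,
    a quarter for the contribution \<open>m * \<epsilon>'\<close> of the larger families over total
    time \<open>c + s\<close>, and a quarter for the one-step errors, kept below \<open>d\<close>
    per unit of time.\<close>
  define \<epsilon>' where "\<epsilon>' = \<epsilon> / (4 * (real m + 1) * (c + s))"
  have cs: "0 < c + s" using c s by simp
  have e': "0 < \<epsilon>'" unfolding \<epsilon>'_def using Suc.prems cs by simp
  have me': "real m * \<epsilon>' * (c + s) \<le> \<epsilon> / 4"
  proof -
    have "real m * \<epsilon>' * (c + s) = \<epsilon> / 4 * (real m / (real m + 1))"
    proof -
      have "a * (\<epsilon> / (4 * b * z)) * z = \<epsilon> / 4 * (a / b)" if "0 < z" "0 < b" for a b z :: real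
        using that by (simp add: field_simps)
      from this[OF cs, of "real m + 1" "real m"] show ?thesis unfolding \<epsilon>'_def by simp
    qed
    also have "\<dots> \<le> \<epsilon> / 4 * 1" using Suc.prems by (intro mult_left_mono) auto
    finally show ?thesis by simp
  qed
  define d where "d = \<epsilon> / (4 * (c + s))"
  have d: "0 < d" "(c + s) * d = \<epsilon> / 4"
  proof -
    have "z * (\<epsilon> / (4 * z)) = \<epsilon> / 4" if "0 < z" for z using that by simp
    from this[OF cs] show "(c + s) * d = \<epsilon> / 4" unfolding d_def .
    show "0 < d" unfolding d_def using Suc.prems cs by simp
  qed
  have "\<forall>\<^sub>F n in sequentially. step_error k t (c + s) (real m) n < d"
    using order_tendstoD(2)[OF step_error_tendsto_0[OF t] d(1)] .
  moreover have "\<forall>\<^sub>F n in sequentially. 2 * (c + s) \<le> real ((n - t) choose (k - t))"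
    using filterlim_binomial_degree[OF t(2)] by (simp add: filterlim_at_top)
  moreover have "\<forall>\<^sub>F n in sequentially.
     \<forall>i. real i * step_length k t n \<le> c \<longrightarrow> survival_close k t m (\<epsilon> / 2) n i"
    using lim Suc.prems unfolding survival_limit_def by simp
  moreover note Suc.IH[OF e', of "m + q"]
  moreover note eventually_ge_at_top[of k]
  ultimately show ?case
  proof eventually_elim
    case (elim n)
    define h where "h = step_length k t n"
    \<comment> \<open>The last index whose time does not exceed \<open>c\<close>.\<close>
    define i0 where "i0 = nat \<lfloor>c / h\<rfloor>"
    \<comment> \<open>The linear term collects the errors that build up at a constant rate. The
      Taylor term vanishes for \<open>i \<le> i0\<close>, where the truncated difference
      \<open>i - i0\<close> is 0, and starts to grow at time \<open>c\<close>.\<close>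
    define B where "B i = \<epsilon> / 2 + real i * h * (real m * \<epsilon>' + d) +
      taylor_coeff (real q) (real m) (Suc J) * (h * real (i - i0)) ^ Suc J" for i
    have h: "0 < h" unfolding h_def step_length_def using t elim(5) by simp
    have i0: "real i * h \<le> c \<longleftrightarrow> i \<le> i0" for i
    proof -
      have "real i * h \<le> c \<longleftrightarrow> real i \<le> c / h" using h by (simp add: field_simps)
      also have "\<dots> \<longleftrightarrow> i \<le> i0" unfolding i0_def using c h by (simp add: le_nat_iff le_floor_iff)
      finally show ?thesis .
    qed
    have tc: "0 \<le> taylor_coeff (real q) x j" if "0 \<le> x" for x j
      using taylor_coeff_nonneg q that by simp
    have B: "survival_close k t m (B i) n i" if "real i * h \<le> c + s" for i
      using that
    proof (induction i)
      case 0
      have "survival_close k t m (\<epsilon> / 2) n 0" using elim(3) c by simp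
      moreover have "\<epsilon> / 2 \<le> B 0" unfolding B_def by simp
      ultimately show ?case by (rule survival_close_mono)
    next
      case (Suc i)
      have ih: "real i * h \<le> c + s" using Suc.prems h by (simp add: algebra_simps)
      show ?case
      proof (cases "Suc i \<le> i0")
        case True
        then have "survival_close k t m (\<epsilon> / 2) n (Suc i)"
          using elim(3) i0[of "Suc i"] by (simp add: h_def)
        moreover have "\<epsilon> / 2 \<le> B (Suc i)"
          unfolding B_def using e' d h True by simp
        ultimately show ?thesis by (rule survival_close_mono)
      next
        case False
        define w where "w = h * real (i - i0)"
        have w: "0 \<le> w" "h * real (Suc i - i0) = w + h"
          unfolding w_def using h False by (simp_all add: Suc_diff_le algebra_simps)
        define b where "b = \<epsilon>' + taylor_coeff (real q) (real m + real q) J * w ^ J"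
        have b0: "0 \<le> b" unfolding b_def using e' w tc[of "real m + real q"] by simp
        have close: "survival_close k t (m + q) b n i"
          using elim(4) ih unfolding b_def w_def h_def i0_def by simp
        \<comment> \<open>The increment of \<open>B\<close> pays for one step: the linear term
          covers \<epsilon>' and \<open>d\<close>, and the Taylor term covers the rest by
          \<open>taylor_coeff_Suc\<close> and \<open>power_Suc_add_le\<close>.\<close>
        have up: "B i + real m * h * b + h * step_error k t (c + s) (real m) n \<le> B (Suc i)"
        proof -
          have "real m * h * b = h * (real m * \<epsilon>') + h * w ^ J * (real m * taylor_coeff (real q) (real m + real q) J)"
            unfolding b_def by (simp add: algebra_simps)
          also have "\<dots> = h * (real m * \<epsilon>') + taylor_coeff (real q) (real m) (Suc J) * (real (Suc J) * h * w ^ J)"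
            unfolding taylor_coeff_Suc by (simp add: algebra_simps)
          finally have 1: "real m * h * b = \<dots>" .
          have 2: "h * step_error k t (c + s) (real m) n \<le> h * (d)"
            using elim(1) h by (intro mult_left_mono) auto
          have "taylor_coeff (real q) (real m) (Suc J) * (w ^ Suc J + real (Suc J) * h * w ^ J)
             \<le> taylor_coeff (real q) (real m) (Suc J) * (w + h) ^ Suc J"
            using w h tc by (intro mult_left_mono power_Suc_add_le) auto
          then have 3: "taylor_coeff (real q) (real m) (Suc J) * w ^ Suc J +
              taylor_coeff (real q) (real m) (Suc J) * (real (Suc J) * h * w ^ J)
             \<le> taylor_coeff (real q) (real m) (Suc J) * (w + h) ^ Suc J"
            by (simp only: distrib_left)
          have 4: "B (Suc i) = \<epsilon> / 2 + real i * h * (real m * \<epsilon>' + d) + h * (real m * \<epsilon>') +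
              h * (d) + taylor_coeff (real q) (real m) (Suc J) * (w + h) ^ Suc J"
            unfolding B_def w(2) by (simp add: algebra_simps)
          have 5: "B i = \<epsilon> / 2 + real i * h * (real m * \<epsilon>' + d) +
              taylor_coeff (real q) (real m) (Suc J) * w ^ Suc J"
            unfolding B_def w_def by simp
          show ?thesis unfolding 1 4 5 using 2 3 by linarith
        qed
        have "\<bar>survival {..<n} k t (Suc i) F - ref_survival (real q) (real m) (real (Suc i) * h)\<bar> \<le> B (Suc i)"
          if F: "F \<subseteq> nsets {..<n} t" "card F = m" for F
        proof -
          have "\<bar>survival {..<n} k t (Suc i) F - ref_survival (real q) (real (card F)) (real (Suc i) * h)\<bar>
            \<le> B i + real (card F) * h * b + h * step_error k t (c + s) (real (card F)) n"
            unfolding h_def q_def using survival_step[of "{..<n}" t k F i "c + s" "B i" b] t elim(2,5) F ih b0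
              close Suc.IH[OF ih] unfolding survival_close_def h_def q_def by simp
          then show ?thesis using up F(2) by simp
        qed
        then show ?thesis unfolding survival_close_def h_def q_def by blast
      qed
    qed
    show ?case
    proof (intro allI impI)
      fix i assume i: "real i * step_length k t n \<le> c + s"
      have "real i * h * (real m * \<epsilon>' + d) \<le> (c + s) * (real m * \<epsilon>' + d)"
        using i e' d cs unfolding h_def by (intro mult_right_mono) auto
      also have "\<dots> = real m * \<epsilon>' * (c + s) + \<epsilon> / 4" using d(2) by (simp add: algebra_simps)
      also have "\<dots> \<le> \<epsilon> / 2" using me' by simp
      finally have "B i \<le> \<epsilon> + taylor_coeff (real q) (real m) (Suc J) * (h * real (i - i0)) ^ Suc J"
        unfolding B_def by linarith
      then show "survival_close k t m (\<epsilon> + taylor_coeff (real q) (real m) (Suc J) *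
          (step_length k t n * real (i - nat \<lfloor>c / step_length k t n\<rfloor>)) ^ Suc J) n i"
        using B[of i] i survival_close_mono unfolding h_def i0_def by blast
    qed
  qed
qed

lemma survival_limit_0:
  assumes "0 < t" "t < k"
  shows "survival_limit k t 0"
  unfolding survival_limit_def
proof (intro allI impI)
  fix m :: nat and \<epsilon> :: real assume e: "0 < \<epsilon>"
  have "survival_close k t m \<epsilon> n i" if n: "k \<le> n" and i: "real i * step_length k t n \<le> 0" for n i
  proof -
    have "0 < step_length k t n" unfolding step_length_def using assms n by simp
    then have "i = 0" using i by (simp add: mult_le_0_iff)
    then show ?thesis using e by (simp add: survival_close_def survival_0)
  qed
  then show "\<forall>\<^sub>F n in sequentially. \<forall>i. real i * step_length k t n \<le> 0 \<longrightarrow> survival_close k t m \<epsilon> n i"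
    unfolding eventually_sequentially by blast
qed

text \<open>
  The Taylor series converges for times below \<open>1 / q\<close>, whatever the starting time; hence the limit
  can be continued by a fixed amount as often as desired.
\<close>

lemma survival_limit_extend:
  assumes t: "0 < t" "t < k" and c: "0 \<le> c" and lim: "survival_limit k t c"
  shows "survival_limit k t (c + 1 / (2 * real ((k choose t) - 1)))"
  unfolding survival_limit_def
proof (intro allI impI)
  fix m :: nat and \<epsilon> :: real assume e: "0 < \<epsilon>"
  define q where "q = real ((k choose t) - 1)"
  \<comment> \<open>The extension \<open>s\<close> stays below \<open>x\<close>, and
    \<open>x\<close> below the radius of convergence \<open>1 / q\<close>. The gap
    \<open>x - s\<close> absorbs rounding: the index of time \<open>c\<close> may fall short of
    \<open>c\<close> by up to one step, so the elapsed time can slightly exceed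
    \<open>s\<close>.\<close>
  define s where "s = 1 / (2 * q)"
  define x where "x = 3 / (4 * q)"
  have q: "0 < q" using choose_gt_1[OF t] by (simp add: q_def)
  have s: "0 < s" and x: "0 \<le> x" "x * q < 1" and sx: "x - s = 1 / (4 * q)"
    unfolding s_def x_def using q by (simp_all add: field_simps)
  have "\<forall>\<^sub>F J in sequentially. taylor_coeff q (real m) J * x ^ J < \<epsilon> / 2"
    by (rule order_tendstoD(2)[OF taylor_remainder_tendsto_0[OF q _ x]]) (use e in simp_all)
  then obtain J where J: "taylor_coeff q (real m) J * x ^ J < \<epsilon> / 2"
    unfolding eventually_sequentially by blast
  have "\<forall>\<^sub>F n in sequentially. step_length k t n < x - s"
    using order_tendstoD(2)[OF step_length_tendsto_0[OF t(1)]] q unfolding sx by simp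
  moreover have "\<forall>\<^sub>F n in sequentially. \<forall>i. real i * step_length k t n \<le> c + s \<longrightarrow>
    survival_close k t m (\<epsilon> / 2 + taylor_coeff q (real m) J *
      (step_length k t n * real (i - nat \<lfloor>c / step_length k t n\<rfloor>)) ^ J) n i"
    unfolding q_def by (rule survival_close_taylor[OF t c s lim]) (use e in simp)
  moreover note eventually_ge_at_top[of k]
  ultimately show "\<forall>\<^sub>F n in sequentially. \<forall>i. real i * step_length k t n
      \<le> c + 1 / (2 * real ((k choose t) - 1)) \<longrightarrow> survival_close k t m \<epsilon> n i"
    unfolding q_def[symmetric] s_def[symmetric]
  proof eventually_elim
    case (elim n)
    define h where "h = step_length k t n"
    have h: "0 < h" "h < x - s" using elim t unfolding h_def step_length_def by simp_all
    show ?case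
    proof (intro allI impI)
      fix i assume i: "real i * step_length k t n \<le> c + s"
      have "h * real (i - nat \<lfloor>c / h\<rfloor>) \<le> x"
      proof (cases "i \<le> nat \<lfloor>c / h\<rfloor>")
        case False
        have "c / h < real (nat \<lfloor>c / h\<rfloor>) + 1" using c h by linarith
        then have "c < h * real (nat \<lfloor>c / h\<rfloor>) + h" using h by (simp add: field_simps)
        moreover have "h * real (i - nat \<lfloor>c / h\<rfloor>) = real i * h - h * real (nat \<lfloor>c / h\<rfloor>)"
          using False by (simp add: of_nat_diff algebra_simps)
        ultimately show ?thesis using i h unfolding h_def by linarith
      qed (use x in simp)
      then have "(h * real (i - nat \<lfloor>c / h\<rfloor>)) ^ J \<le> x ^ J" using h by (intro power_mono) auto
      then have "taylor_coeff q (real m) J * (h * real (i - nat \<lfloor>c / h\<rfloor>)) ^ J \<le> taylor_coeff q (real m) J * x ^ J"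
        using q by (intro mult_left_mono taylor_coeff_nonneg) auto
      then have "\<epsilon> / 2 + taylor_coeff q (real m) J * (h * real (i - nat \<lfloor>c / h\<rfloor>)) ^ J \<le> \<epsilon>"
        using J by linarith
      moreover have "survival_close k t m (\<epsilon> / 2 + taylor_coeff q (real m) J * (h * real (i - nat \<lfloor>c / h\<rfloor>)) ^ J) n i"
        using elim i unfolding h_def by blast
      ultimately show "survival_close k t m \<epsilon> n i" by (rule survival_close_mono[rotated])
    qed
  qed
qed

lemma survival_limit_all:
  assumes t: "0 < t" "t < k"
  shows "survival_limit k t (real j / (2 * real ((k choose t) - 1)))"
proof (induction j)
  case (Suc j)
  have "real (Suc j) / (2 * real ((k choose t) - 1)) =
      real j / (2 * real ((k choose t) - 1)) + 1 / (2 * real ((k choose t) - 1))"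
    by (simp add: add_divide_distrib)
  then show ?case using survival_limit_extend[OF t _ Suc] by simp
qed (simp add: survival_limit_0[OF t])

section \<open>Uncovered \<open>t\<close>-sets and the expected size of a greedy covering\<close>

lemma prob_uncovered_eventually_le:
  assumes t: "0 < t" "t < k" and e: "0 < \<epsilon>"
  shows "\<forall>\<^sub>F n in sequentially. \<forall>T\<in>nsets {..<n} t.
    measure_pmf.prob (pmf_of_set (permutations_of_set (nsets {..<n} k))) {xs. \<not> covered (greedy t xs) T} \<le> \<epsilon>"
proof -
  define q where "q = real ((k choose t) - 1)"
  have q: "0 < q" using choose_gt_1[OF t] by (simp add: q_def)
  have "\<forall>\<^sub>F x in at_top. ref_survival q 1 x < \<epsilon> / 2"
    by (rule order_tendstoD(2)[OF ref_survival_tendsto_0[OF q, of 1]]) (use e in simp_all)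
  then obtain x0 where x0: "ref_survival q 1 x < \<epsilon> / 2" if "x0 \<le> x" for x
    unfolding eventually_at_top_linorder by blast
  \<comment> \<open>The time \<open>c = j / (2 * q)\<close> has the form supplied by
    \<open>survival_limit_all\<close> and is at least \<open>x0 + 1\<close>. The extra 1 allows for
    rounding, since the index \<open>i\<close> chosen below only satisfies
    \<open>i * h > c - h\<close>.\<close>
  obtain j :: nat where j: "2 * q * (max x0 0 + 1) \<le> real j" using real_arch_simple by blast
  define c where "c = real j / (2 * q)"
  have c: "max x0 0 + 1 \<le> c" unfolding c_def using j q by (simp add: field_simps)
  have "survival_limit k t c" unfolding c_def q_def by (rule survival_limit_all[OF t])
  then have "\<forall>\<^sub>F n in sequentially. \<forall>i. real i * step_length k t n \<le> c \<longrightarrow> survival_close k t 1 (\<epsilon> / 2) n i"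
    unfolding survival_limit_def using e by simp
  moreover have "\<forall>\<^sub>F n in sequentially. step_length k t n < 1"
    using order_tendstoD(2)[OF step_length_tendsto_0[OF t(1)]] by simp
  moreover note eventually_ge_at_top[of k]
  ultimately show ?thesis
  proof eventually_elim
    case (elim n)
    define h where "h = step_length k t n"
    have h: "0 < h" "h < 1" using elim t unfolding h_def step_length_def by simp_all
    define i where "i = nat \<lfloor>c / h\<rfloor>"
    have "0 \<le> c / h" using c h by simp
    then have "real i \<le> c / h" "c / h < real i + 1" unfolding i_def by linarith+
    then have i: "real i * h \<le> c" "c < real i * h + h" using h by (simp_all add: field_simps)
    show ?case
    proof
      fix T assume T: "T \<in> nsets {..<n} t"
      have "survival_close k t 1 (\<epsilon> / 2) n i" using elim i(1) unfolding h_def by blast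
      then have "\<bar>survival {..<n} k t i {T} - ref_survival q 1 (real i * h)\<bar> \<le> \<epsilon> / 2"
        using T unfolding survival_close_def h_def[symmetric] q_def[symmetric]
        by (elim allE[of _ "{T}"]) simp
      then have "survival {..<n} k t i {T} \<le> ref_survival q 1 (real i * h) + \<epsilon> / 2" by linarith
      also have "ref_survival q 1 (real i * h) < \<epsilon> / 2" using x0 c i h by simp
      finally have "survival {..<n} k t i {T} \<le> \<epsilon>" by simp
      \<comment> \<open>What is covered after \<open>i\<close> blocks stays covered, so being
        uncovered at the end is the rarer event.\<close>
      moreover have "measure_pmf.prob (pmf_of_set (permutations_of_set (nsets {..<n} k))) {xs. \<not> covered (greedy t xs) T}
          \<le> survival {..<n} k t i {T}"
        unfolding survival_def
      proof (rule measure_pmf.finite_measure_mono)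
        have "covered (greedy t xs) T" if "covered (greedy t (take i xs)) T" for xs
          using covered_mono[OF that greedy_mono[of t "take i xs" "drop i xs"]] by simp
        then show "{xs. \<not> covered (greedy t xs) T} \<subseteq> {xs. uncovered_all t (take i xs) {T}}"
          by (auto simp: uncovered_all_def)
      qed simp
      ultimately show "measure_pmf.prob (pmf_of_set (permutations_of_set (nsets {..<n} k)))
          {xs. \<not> covered (greedy t xs) T} \<le> \<epsilon>" by linarith
    qed
  qed
qed

text \<open>The packing bound holds for every ordering, and by linearity the expected number of
  uncovered \<open>t\<close>-sets is at most \<epsilon> times their number.\<close>

lemma expectation_greedy_size_eventually_le:
  assumes t: "0 < t" "t \<le> k" and e: "0 < \<epsilon>"
  shows "\<forall>\<^sub>F n in sequentially.
    measure_pmf.expectation (pmf_of_set (permutations_of_set (nsets {..<n} k))) (\<lambda>xs. real (greedy_size t {..<n} xs))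
    \<le> (1 / real (k choose t) + \<epsilon>) * real (n choose t)"
proof -
  let ?p = "\<lambda>n::nat. pmf_of_set (permutations_of_set (nsets {..<n} k))"
  have sp: "set_pmf (?p n) = permutations_of_set (nsets {..<n} k)" for n
    by (simp add: set_pmf_random_order)
  have "\<forall>\<^sub>F n in sequentially. \<forall>T\<in>nsets {..<n} t. measure_pmf.prob (?p n) {xs. \<not> covered (greedy t xs) T} \<le> \<epsilon>"
  proof (cases "t < k")
    case True
    then show ?thesis using prob_uncovered_eventually_le t e by blast
  next
    case False
    then have kt: "k = t" using t by simp
    have "measure_pmf.prob (?p n) {xs. \<not> covered (greedy t xs) T} \<le> \<epsilon>" if T: "T \<in> nsets {..<n} t" for n T
    proof -
      have "finite T" "card T = t" using T by (auto simp: nsets_def)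
      then have Tt: "nsets T t = {T}" using card_subset_eq[of T] by (auto simp: nsets_def)
      have "covered (greedy t xs) T" if "xs \<in> set_pmf (?p n)" for xs
      proof -
        have "set xs = nsets {..<n} k" using that unfolding sp by (simp add: permutations_of_set_def)
        then have "T \<in> set xs" using T kt by simp
        then have "\<not> admissible t (greedy t xs) T" using Tt by (intro not_admissible_greedy) auto
        then show ?thesis by (simp add: admissible_def Tt)
      qed
      then have "measure_pmf.prob (?p n) {xs. \<not> covered (greedy t xs) T} = 0"
        by (subst measure_pmf_zero_iff) blast
      then show ?thesis using e by simp
    qed
    then show ?thesis by (intro always_eventually) blast
  qed
  then show ?thesis
  proof eventually_elim
    case (elim n)
    let ?N = "nsets {..<n} t"
    have Q: "0 < real (k choose t)" using t by simp
    have finN: "finite ?N" by (simp add: finite_imp_finite_nsets)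
    have int: "integrable (measure_pmf (?p n)) f" for f :: "_ \<Rightarrow> real"
      by (rule integrable_measure_pmf_finite) (simp add: sp)
    have card_eq: "real (card {T\<in>?N. \<not> covered (greedy t xs) T}) =
        (\<Sum>T\<in>?N. indicator {xs. \<not> covered (greedy t xs) T} xs)" for xs
      using finN by (simp add: indicator_def sum.If_cases Int_def)
    have "measure_pmf.expectation (?p n) (\<lambda>xs. real (greedy_size t {..<n} xs)) \<le>
        measure_pmf.expectation (?p n) (\<lambda>xs. real (n choose t) / real (k choose t) +
          (\<Sum>T\<in>?N. indicator {xs. \<not> covered (greedy t xs) T} xs))"
    proof (rule integral_mono_AE[OF int int], rule AE_pmfI)
      fix xs assume "xs \<in> set_pmf (?p n)"
      then have "set xs \<subseteq> nsets {..<n} k" unfolding sp by (simp add: permutations_of_set_def)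
      from card_greedy_le[OF _ this t(2)]
      have "real (card (greedy t xs)) \<le> real (n choose t) / real (k choose t)"
        using Q by (simp add: field_simps)
      then show "real (greedy_size t {..<n} xs) \<le> real (n choose t) / real (k choose t) +
          (\<Sum>T\<in>?N. indicator {xs. \<not> covered (greedy t xs) T} xs)"
        unfolding greedy_size_def of_nat_add card_eq by simp
    qed
    also have "\<dots> = real (n choose t) / real (k choose t) +
        (\<Sum>T\<in>?N. measure_pmf.prob (?p n) {xs. \<not> covered (greedy t xs) T})"
      by (simp add: int Bochner_Integration.integral_add)
    also have "\<dots> \<le> real (n choose t) / real (k choose t) + (\<Sum>T\<in>?N. \<epsilon>)"
      using elim by (intro add_left_mono sum_mono) auto
    also have "\<dots> = (1 / real (k choose t) + \<epsilon>) * real (n choose t)"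
      by (simp add: algebra_simps)
    finally show ?case .
  qed
qed

subsection \<open>Hyperplanes of the affine geometry\<close>

definition plane :: "nat \<Rightarrow> nat \<Rightarrow> point \<Rightarrow> int \<Rightarrow> point set" where
  "plane t p a c = {x \<in> AG t p. [(\<Sum>i<t. a i * x i) = c] (mod int p)}"

lemma hyperplanes_eq:
  "hyperplanes t p = {plane t p a c | a c. \<exists>i<t. \<not> [a i = 0] (mod int p)}"
  by (auto simp: hyperplanes_def plane_def)

lemma finite_AG [simp]: "finite (AG t p)"
  by (simp add: AG_def finite_PiE)

lemma card_AG [simp]: "card (AG t p) = p ^ t"
  by (simp add: AG_def card_funcsetE)

lemma hyperplane_subset: "H \<in> hyperplanes t p \<Longrightarrow> H \<subseteq> AG t p"
  by (auto simp: hyperplanes_eq plane_def)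

lemma finite_hyperplanes [simp]: "finite (hyperplanes t p)"
proof (rule finite_subset)
  show "hyperplanes t p \<subseteq> Pow (AG t p)" using hyperplane_subset by blast
qed simp

lemma not_cong_0_coprime:
  fixes x :: int
  assumes "prime p" "\<not> [x = 0] (mod int p)"
  shows "coprime x (int p)"
proof -
  have "\<not> int p dvd x" using assms(2) by (simp add: cong_0_iff)
  then show ?thesis using prime_imp_coprime[of "int p" x] assms(1) by (simp add: coprime_commute)
qed

lemma cong_imp_eq_range:
  fixes x y :: int
  assumes "[x = y] (mod int p)" "x \<in> {0..<int p}" "y \<in> {0..<int p}"
  shows "x = y"
  using assms by (simp add: cong_def)

text \<open>Some coefficient \<open>a j\<close> is invertible modulo \<open>p\<close>, so the other
  \<open>t - 1\<close> coordinates are free and determine coordinate \<open>j\<close>: forgetting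
  that coordinate is a bijection.\<close>

lemma card_hyperplane:
  assumes p: "prime p" and H: "H \<in> hyperplanes t p"
  shows "card H = p ^ (t - 1)"
proof -
  obtain a c j where H: "H = plane t p a c" and j: "j < t" "\<not> [a j = 0] (mod int p)"
    using H unfolding hyperplanes_eq by blast
  obtain b where b: "[a j * b = 1] (mod int p)"
    using cong_solve_coprime_int[OF not_cong_0_coprime[OF p j(2)]] by blast
  have p0: "0 < int p" using p prime_gt_0_nat by simp
  let ?I = "{..<t} - {j}"
  define s where "s y = (\<Sum>i\<in>?I. a i * y i)" for y
  define v where "v y = (b * (c - s y)) mod int p" for y
  have I: "{..<t} = insert j ?I" using j by auto
  have sum: "(\<Sum>i<t. a i * x i) = a j * x j + s x" for x
    unfolding s_def using j by (subst sum.remove[of _ j]) auto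
  have scong: "s x = s y" if "\<And>i. i \<in> ?I \<Longrightarrow> x i = y i" for x y
    unfolding s_def using that by (intro sum.cong) auto
  have av: "[a j * v y + s y = c] (mod int p)" for y
  proof -
    have "[a j * v y = a j * (b * (c - s y))] (mod int p)"
      unfolding v_def by (intro cong_mult cong_refl) (simp add: cong_def)
    also have "a j * (b * (c - s y)) = (a j * b) * (c - s y)" by (simp add: mult.assoc)
    also have "[\<dots> = 1 * (c - s y)] (mod int p)" using b by (rule cong_mult) (rule cong_refl)
    finally have "[a j * v y + s y = 1 * (c - s y) + s y] (mod int p)" by (rule cong_add) (rule cong_refl)
    then show ?thesis by simp
  qed
  have vr: "v y \<in> {0..<int p}" for y unfolding v_def using p0 by simp
  have uniq: "x j = v x" if x: "x \<in> plane t p a c" for x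
  proof -
    have "[a j * x j + s x = a j * v x + s x] (mod int p)"
      using cong_trans[OF _ cong_sym[OF av]] x unfolding plane_def sum by blast
    then have "[a j * x j = a j * v x] (mod int p)" by (simp add: cong_add_rcancel)
    then have "[x j = v x] (mod int p)"
      using cong_mult_lcancel[OF not_cong_0_coprime[OF p j(2)]] by simp
    moreover have "x j \<in> {0..<int p}" using x j unfolding plane_def AG_def by blast
    ultimately show ?thesis using vr by (rule cong_imp_eq_range)
  qed
  have "bij_betw (\<lambda>x. restrict x ?I) H (?I \<rightarrow>\<^sub>E {0..<int p})"
  proof (rule bij_betw_byWitness[where f' = "\<lambda>y. y(j := v y)"])
    show "\<forall>x\<in>H. (restrict x ?I)(j := v (restrict x ?I)) = x"
    proof (intro ballI ext)
      fix x i assume x: "x \<in> H"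
      have "s (restrict x ?I) = s x" by (rule scong) simp
      then have v: "v (restrict x ?I) = x j" using uniq x unfolding H v_def by simp
      have "x i = undefined" if "i \<notin> {..<t}" using x that unfolding H plane_def AG_def by blast
      then show "((restrict x ?I)(j := v (restrict x ?I))) i = x i" using v by auto
    qed
    show "\<forall>y\<in>?I \<rightarrow>\<^sub>E {0..<int p}. restrict (y(j := v y)) ?I = y"
    proof (intro ballI ext)
      fix y i assume "y \<in> ?I \<rightarrow>\<^sub>E {0..<int p}"
      then have "y i = undefined" if "i \<notin> ?I" using that by blast
      then show "restrict (y(j := v y)) ?I i = y i" by (auto simp: restrict_def)
    qed
    show "(\<lambda>x. restrict x ?I) ` H \<subseteq> ?I \<rightarrow>\<^sub>E {0..<int p}"
    proof (intro image_subsetI restrict_PiE_iff[THEN iffD2] ballI)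
      fix x i assume "x \<in> H" "i \<in> ?I"
      then show "x i \<in> {0..<int p}" unfolding H plane_def AG_def by blast
    qed
    have "y(j := v y) \<in> H" if y: "y \<in> ?I \<rightarrow>\<^sub>E {0..<int p}" for y
    proof -
      have "y(j := v y) \<in> insert j ?I \<rightarrow>\<^sub>E {0..<int p}" using y vr by (intro PiE_fun_upd)
      then have "y(j := v y) \<in> AG t p" unfolding AG_def I[symmetric] .
      moreover have "s (y(j := v y)) = s y"
      proof (rule scong)
        fix i assume "i \<in> ?I"
        then have "i \<noteq> j" by blast
        then show "(y(j := v y)) i = y i" by (rule fun_upd_other)
      qed
      then have "(\<Sum>i<t. a i * (y(j := v y)) i) = a j * v y + s y"
        using sum[of "y(j := v y)"] by (simp only: fun_upd_same)
      ultimately show ?thesis unfolding H plane_def mem_Collect_eq using av[of y] by argo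
    qed
    then show "(\<lambda>y. y(j := v y)) ` (?I \<rightarrow>\<^sub>E {0..<int p}) \<subseteq> H" by blast
  qed
  then have "card H = card (?I \<rightarrow>\<^sub>E {0..<int p})" by (rule bij_betw_same_card)
  also have "\<dots> = p ^ (t - 1)" using j by (simp add: card_funcsetE)
  finally show ?thesis .
qed

text \<open>The nonzero multiples of an equation define the same hyperplane, so each hyperplane has
  at least \<open>p - 1\<close> reduced equations. Different hyperplanes share none, and there are
  \<open>p ^ t * p\<close> reduced pairs of coefficients and constant.\<close>

lemma card_hyperplanes_le:
  assumes p: "prime p"
  shows "card (hyperplanes t p) * (p - 1) \<le> p ^ t * p"
proof -
  \<comment> \<open>\<open>AG t p\<close> serves here as the set of reduced coefficient vectors. The
    zero vector is included, which is harmless for an upper bound.\<close>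
  define R where "R = AG t p \<times> {0..<int p}"
  define S where "S H = {(a, c)\<in>R. plane t p a c = H}" for H
  have p0: "0 < int p" using p prime_gt_0_nat by simp
  have finR: "finite R" unfolding R_def by simp
  have SR: "S H \<subseteq> R" for H unfolding S_def by blast
  have "p - 1 \<le> card (S H)" if H: "H \<in> hyperplanes t p" for H
  proof -
    obtain a c j where H: "H = plane t p a c" and j: "j < t" "\<not> [a j = 0] (mod int p)"
      using H unfolding hyperplanes_eq by blast
    define f where "f l = ((\<lambda>i\<in>{..<t}. (l * a i) mod int p), (l * c) mod int p)" for l
    have "inj_on f {1..<int p}"
    proof (rule inj_onI)
      fix l l' assume l: "l \<in> {1..<int p}" "l' \<in> {1..<int p}" "f l = f l'"
      then have "(\<lambda>i\<in>{..<t}. (l * a i) mod int p) j = (\<lambda>i\<in>{..<t}. (l' * a i) mod int p) j"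
        unfolding f_def by simp
      then have "[l * a j = l' * a j] (mod int p)" using j by (simp add: cong_def)
      then have "[l = l'] (mod int p)"
        using cong_mult_rcancel[OF not_cong_0_coprime[OF p j(2)]] by simp
      then show "l = l'" by (rule cong_imp_eq_range) (use l in auto)
    qed
    then have "card (f ` {1..<int p}) = p - 1" by (simp add: card_image nat_diff_distrib)
    moreover have "f l \<in> S H" if l: "l \<in> {1..<int p}" for l
    proof -
      have "\<not> [l = 0] (mod int p)" using l by (simp add: cong_def)
      then have cop: "coprime l (int p)" by (rule not_cong_0_coprime[OF p])
      have "[(\<Sum>i<t. (\<lambda>i\<in>{..<t}. (l * a i) mod int p) i * x i) = (l * c) mod int p] (mod int p) \<longleftrightarrow>
          [(\<Sum>i<t. a i * x i) = c] (mod int p)" for x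
      proof -
        have "[(\<Sum>i<t. (\<lambda>i\<in>{..<t}. (l * a i) mod int p) i * x i) = (\<Sum>i<t. l * (a i * x i))] (mod int p)"
        proof (rule cong_sum)
          fix i assume "i \<in> {..<t}"
          then show "[(\<lambda>i\<in>{..<t}. (l * a i) mod int p) i * x i = l * (a i * x i)] (mod int p)"
            by (simp add: cong_def mod_mult_left_eq mult.assoc flip: mult.assoc)
        qed
        then have 1: "[(\<Sum>i<t. (\<lambda>i\<in>{..<t}. (l * a i) mod int p) i * x i) = l * (\<Sum>i<t. a i * x i)] (mod int p)"
          by (simp add: sum_distrib_left)
        have 2: "[(l * c) mod int p = l * c] (mod int p)" by (simp add: cong_def)
        have "[(\<Sum>i<t. (\<lambda>i\<in>{..<t}. (l * a i) mod int p) i * x i) = (l * c) mod int p] (mod int p) \<longleftrightarrow>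
            [l * (\<Sum>i<t. a i * x i) = l * c] (mod int p)"
          using 1 2 cong_trans cong_sym by meson
        then show ?thesis using cong_mult_lcancel[OF cop] by simp
      qed
      then have "plane t p (fst (f l)) (snd (f l)) = H" unfolding H f_def plane_def by simp
      moreover have "f l \<in> R" unfolding R_def f_def AG_def using p0 by (auto simp: PiE_iff)
      ultimately show ?thesis unfolding S_def by (auto simp: case_prod_beta)
    qed
    then have "f ` {1..<int p} \<subseteq> S H" by blast
    then have "card (f ` {1..<int p}) \<le> card (S H)"
      using finite_subset[OF SR finR] by (intro card_mono)
    ultimately show ?thesis by simp
  qed
  then have "card (hyperplanes t p) * (p - 1) \<le> (\<Sum>H\<in>hyperplanes t p. card (S H))"
    using sum_bounded_below[of "hyperplanes t p" "p - 1" "\<lambda>H. card (S H)"] by simp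
  also have "\<dots> = card (\<Union>H\<in>hyperplanes t p. S H)"
  proof (rule card_UN_disjoint[symmetric])
    show "\<forall>H\<in>hyperplanes t p. finite (S H)" using finite_subset[OF SR finR] by blast
    show "\<forall>H\<in>hyperplanes t p. \<forall>H'\<in>hyperplanes t p. H \<noteq> H' \<longrightarrow> S H \<inter> S H' = {}"
      unfolding S_def by auto
  qed simp
  also have "\<dots> \<le> card R" using SR by (intro card_mono[OF finR]) blast
  also have "\<dots> = p ^ t * p" unfolding R_def by (simp add: card_cartesian_product)
  finally show ?thesis .
qed

text \<open>
  A hyperplane through \<open>t\<close> points is a nontrivial solution of \<open>t\<close> homogeneous equations in
  \<open>t + 1\<close> unknowns, which exists by the pigeonhole principle.
\<close>

lemma nsets_AG_subset_hyperplane: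
  assumes p: "prime p" and t: "0 < t" and T: "T \<in> nsets (AG t p) t"
  shows "\<exists>H\<in>hyperplanes t p. T \<subseteq> H"
proof -
  let ?P = "{0..<int p}"
  have p2: "2 \<le> p" using p by (rule prime_ge_2_nat)
  have T: "finite T" "card T = t" "T \<subseteq> AG t p" using T by (auto simp: nsets_def)
  \<comment> \<open>\<open>u\<close> lists \<open>t\<close> coefficients followed by a constant term
    \<open>u t\<close>, and \<open>f u\<close> evaluates the affine form on \<open>T\<close>. There
    are \<open>p ^ Suc t\<close> forms but only \<open>p ^ t\<close> value vectors, so two forms
    agree on \<open>T\<close>; their difference is the equation sought.\<close>
  define f where "f u = (\<lambda>x\<in>T. ((\<Sum>i<t. u i * x i) + u t) mod int p)" for u :: "nat \<Rightarrow> int"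
  have "\<not> inj_on f ({..t} \<rightarrow>\<^sub>E ?P)"
  proof
    assume inj: "inj_on f ({..t} \<rightarrow>\<^sub>E ?P)"
    have "f ` ({..t} \<rightarrow>\<^sub>E ?P) \<subseteq> T \<rightarrow>\<^sub>E ?P" unfolding f_def using p2 by auto
    from card_inj_on_le[OF inj this] have "p ^ Suc t \<le> p ^ t"
      using T by (simp add: card_funcsetE finite_PiE)
    moreover have "p ^ t < p ^ Suc t" using p2 by (intro power_strict_increasing) auto
    ultimately show False by simp
  qed
  then obtain u u' where u: "u \<in> {..t} \<rightarrow>\<^sub>E ?P" "u' \<in> {..t} \<rightarrow>\<^sub>E ?P" "f u = f u'" "u \<noteq> u'"
    unfolding inj_on_def by blast
  define a where "a i = u i - u' i" for i
  define c where "c = u' t - u t"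
  have eq: "[(\<Sum>i<t. a i * x i) = c] (mod int p)" if "x \<in> T" for x
  proof -
    have "[(\<Sum>i<t. u i * x i) + u t = (\<Sum>i<t. u' i * x i) + u' t] (mod int p)"
      using fun_cong[OF u(3), of x] that unfolding f_def by (simp add: cong_def)
    then have "int p dvd ((\<Sum>i<t. u i * x i) + u t) - ((\<Sum>i<t. u' i * x i) + u' t)"
      by (simp add: cong_iff_dvd_diff)
    also have "((\<Sum>i<t. u i * x i) + u t) - ((\<Sum>i<t. u' i * x i) + u' t) = (\<Sum>i<t. a i * x i) - c"
      unfolding a_def c_def by (simp add: left_diff_distrib sum_subtractf)
    finally show ?thesis by (simp add: cong_iff_dvd_diff)
  qed
  \<comment> \<open>If all coefficients vanished, evaluation at a point of \<open>T\<close> would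
    make the constant vanish too, and the two forms would coincide.\<close>
  have "\<exists>i<t. \<not> [a i = 0] (mod int p)"
  proof (rule ccontr)
    assume "\<not> ?thesis"
    then have a0: "[a i = 0] (mod int p)" if "i < t" for i using that by blast
    have u_eq: "u i = u' i" if "[u i - u' i = 0] (mod int p)" "i \<le> t" for i
    proof (rule cong_imp_eq_range)
      show "[u i = u' i] (mod int p)" using that(1) by (simp add: cong_diff_iff_cong_0)
    qed (use u(1,2) that(2) in blast)+
    obtain x where x: "x \<in> T" using T t by fastforce
    have "[(\<Sum>i<t. a i * x i) = (\<Sum>i<t. 0 * x i)] (mod int p)"
      using a0 by (intro cong_sum cong_mult cong_refl) auto
    then have "[(\<Sum>i<t. a i * x i) = 0] (mod int p)" by simp
    then have "[c = 0] (mod int p)" by (rule cong_trans[OF cong_sym[OF eq[OF x]]])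
    then have "[u t - u' t = 0] (mod int p)" unfolding c_def by (simp add: cong_0_iff dvd_diff_commute)
    then have "u i = u' i" if "i \<in> {..t}" for i
      using u_eq[of i] a0[of i] that unfolding a_def by (cases "i = t") auto
    then have "u = u'" using u(1,2) by (intro PiE_ext) 
    then show False using u(4) by simp
  qed
  then have "plane t p a c \<in> hyperplanes t p" unfolding hyperplanes_eq by blast
  moreover have "T \<subseteq> plane t p a c" unfolding plane_def using T eq by blast
  ultimately show ?thesis by blast
qed

subsection \<open>Random point sets and hyperplanes\<close>

text \<open>Double counting of pairs of a \<open>v\<close>-set \<open>V\<close> and a
  \<open>j\<close>-subset of \<open>H \<inter> V\<close>: every \<open>j\<close>-subset of
  \<open>H\<close> lies in the same number of \<open>v\<close>-sets.\<close>

lemma expectation_binomial_card_Int: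
  assumes "finite \<Omega>" "H \<subseteq> \<Omega>" "v \<le> card \<Omega>" "j \<le> v"
  shows "measure_pmf.expectation (pmf_of_set (nsets \<Omega> v)) (\<lambda>V. real (card (H \<inter> V) choose j)) =
    real (card H choose j) * real (v choose j) / real (card \<Omega> choose j)"
proof -
  let ?N = "card \<Omega>"
  have fin: "finite (nsets \<Omega> v)" using assms(1) by (rule finite_imp_finite_nsets)
  have finH: "finite (nsets H j)" using assms by (meson finite_imp_finite_nsets finite_subset)
  have cN: "card (nsets \<Omega> v) = ?N choose v" by simp
  have "0 < ?N choose v" using assms by simp
  then have ne: "nsets \<Omega> v \<noteq> {}" by (metis card.empty cN less_irrefl)
  have "(\<Sum>V\<in>nsets \<Omega> v. card (H \<inter> V) choose j) = (\<Sum>V\<in>nsets \<Omega> v. card (nsets V j \<inter> nsets H j))"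
  proof (rule sum.cong[OF refl])
    fix V
    have "nsets V j \<inter> nsets H j = nsets (H \<inter> V) j" by (auto simp: nsets_def)
    then show "card (H \<inter> V) choose j = card (nsets V j \<inter> nsets H j)" by simp
  qed
  also have "\<dots> = (\<Sum>J\<in>nsets H j. card {V\<in>nsets \<Omega> v. J \<in> nsets V j})"
    by (rule sum_card_Int_eq[OF fin finH])
  also have "\<dots> = (\<Sum>J\<in>nsets H j. (?N - j) choose (v - j))"
  proof (rule sum.cong[OF refl])
    fix J assume "J \<in> nsets H j"
    then have J: "J \<in> nsets \<Omega> j" "J \<subseteq> \<Omega>" "card J = j" using assms(2) by (auto simp: nsets_def)
    show "card {V\<in>nsets \<Omega> v. J \<in> nsets V j} = (?N - j) choose (v - j)"
      unfolding nsets_mem_iff_subset[OF J(1)] using card_nsets_superset[OF assms(1) J(2), of v] J(3) assms(4)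
      by simp
  qed
  finally have S: "(\<Sum>V\<in>nsets \<Omega> v. card (H \<inter> V) choose j) = (card H choose j) * ((?N - j) choose (v - j))"
    by simp
  have "(?N choose v) * (v choose j) = (?N choose j) * ((?N - j) choose (v - j))"
    using assms by (intro choose_mult)
  then have id: "real (?N choose v) * real (v choose j) = real (?N choose j) * real ((?N - j) choose (v - j))"
    by (simp flip: of_nat_mult)
  have pos: "0 < real (?N choose v)" "0 < real (?N choose j)" using assms by simp_all
  have "measure_pmf.expectation (pmf_of_set (nsets \<Omega> v)) (\<lambda>V. real (card (H \<inter> V) choose j)) =
      real (\<Sum>V\<in>nsets \<Omega> v. card (H \<inter> V) choose j) / real (?N choose v)"
    by (simp add: integral_pmf_of_set[OF ne fin])
  also have "\<dots> = real (card H choose j) * (real ((?N - j) choose (v - j)) / real (?N choose v))"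
    unfolding S by simp
  also have "real ((?N - j) choose (v - j)) / real (?N choose v) = real (v choose j) / real (?N choose j)"
    using id pos by (simp add: field_simps)
  finally show ?thesis by simp
qed

section \<open>Moments of the intersection sizes and their asymptotics\<close>

lemma binomial_mult_self:
  "real X * real (X choose t) = real (Suc t) * real (X choose Suc t) + real t * real (X choose t)"
proof (cases "t \<le> X")
  case True
  have "Suc t * (X choose Suc t) = (X - t) * (X choose t)"
    by (metis binomial_absorb_comp binomial_absorption mult.commute)
  then have "real (Suc t * (X choose Suc t)) = real ((X - t) * (X choose t))" by simp
  then show ?thesis using True unfolding of_nat_mult of_nat_diff[OF True] by (simp add: algebra_simps)
qed (simp add: binomial_eq_0 not_le)

text \<open>Two applications of \<open>binomial_mult_self\<close> expand the weighted square in
  binomial coefficients of \<open>X\<close>, whose expectations are known exactly.\<close>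

lemma binomial_mult_square_diff:
  "real (X choose t) * (real X - \<mu>)\<^sup>2 =
    real (Suc t) * real (Suc (Suc t)) * real (X choose Suc (Suc t)) +
    real (Suc t) * (2 * real t + 1 - 2 * \<mu>) * real (X choose Suc t) +
    (real t - \<mu>)\<^sup>2 * real (X choose t)"
proof -
  have "real (X choose t) * (real X)\<^sup>2 = real X * (real X * real (X choose t))"
    by (simp add: power2_eq_square)
  also have "\<dots> = real (Suc t) * (real X * real (X choose Suc t)) + real t * (real X * real (X choose t))"
    using arg_cong[OF binomial_mult_self[of X t], of "\<lambda>y. real X * y"] by (simp only: algebra_simps)
  also have "\<dots> = real (Suc t) * (real (Suc (Suc t)) * real (X choose Suc (Suc t)) + real (Suc t) * real (X choose Suc t))
      + real t * (real (Suc t) * real (X choose Suc t) + real t * real (X choose t))"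
    unfolding binomial_mult_self[of X t] binomial_mult_self[of X "Suc t"] ..
  finally have 2: "real (X choose t) * (real X)\<^sup>2 = \<dots>" .
  have "real (X choose t) * (real X - \<mu>)\<^sup>2 =
      real (X choose t) * (real X)\<^sup>2 - 2 * \<mu> * (real X * real (X choose t)) + \<mu>\<^sup>2 * real (X choose t)"
    by (simp add: power2_eq_square algebra_simps)
  then show ?thesis unfolding 2 binomial_mult_self[of X t] by (simp add: power2_eq_square algebra_simps)
qed

lemma binomial_ratio_tendsto:
  "(\<lambda>n. real (n choose j) / real n ^ j) \<longlonglongrightarrow> 1 / fact j"
proof (induction j)
  case (Suc j)
  have "(\<lambda>n. (real n - real j) / real n) \<longlonglongrightarrow> 1" by real_asymp
  then have "(\<lambda>n. real (n choose j) / real n ^ j * ((real n - real j) / real n) / real (Suc j)) \<longlonglongrightarrow> 1 / fact j * 1 / real (Suc j)"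
    by (intro tendsto_divide tendsto_mult Suc tendsto_const) auto
  also have "1 / fact j * 1 / real (Suc j) = 1 / (fact (Suc j) :: real)" by simp
  also have "(\<lambda>n. real (n choose j) / real n ^ j * ((real n - real j) / real n) / real (Suc j)) =
      (\<lambda>n. real (n choose Suc j) / real n ^ Suc j)"
  proof
    fix n
    have "real (Suc j) * real (n choose Suc j) = (real n - real j) * real (n choose j)"
      using binomial_mult_self[of n j] by (simp add: algebra_simps)
    then have e: "real (n choose Suc j) = (real n - real j) * real (n choose j) / real (Suc j)"
      by (simp add: field_simps)
    show "real (n choose j) / real n ^ j * ((real n - real j) / real n) / real (Suc j) =
      real (n choose Suc j) / real n ^ Suc j" unfolding e by (simp add: ac_simps)
  qed
  finally show ?case .
qed simp

text \<open>
  The \<open>j\<close>-th factorial moment, divided by \<open>j!\<close>, of the number of points of a random \<open>v\<close>-set on a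
  hyperplane of \<open>AG(t,p)\<close>.
\<close>

definition plane_moment :: "nat \<Rightarrow> nat \<Rightarrow> nat \<Rightarrow> nat \<Rightarrow> real" where
  "plane_moment t p v j =
     real ((p ^ (t - 1)) choose j) * real (v choose j) / real ((p ^ t) choose j)"

text \<open>Each of the three binomials is asymptotically a \<open>j\<close>-th power divided by
  \<open>fact j\<close>; the powers of \<open>p\<close> combine to a single \<open>p ^ j\<close> in
  the denominator.\<close>

lemma plane_moment_tendsto:
  fixes p :: "nat \<Rightarrow> nat"
  assumes t: "2 \<le> t" and p: "filterlim p at_top sequentially"
  shows "(\<lambda>v. plane_moment t (p v) v j / (real v / real (p v)) ^ j) \<longlonglongrightarrow> 1 / fact j"
proof -
  have pw: "filterlim (\<lambda>v. p v ^ s) at_top sequentially" if "0 < s" for s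
  proof (rule filterlim_at_top_mono[OF p])
    have "p v \<le> p v ^ s" for v using that by (cases "p v = 0") (auto intro: self_le_power)
    then show "\<forall>\<^sub>F v in sequentially. p v \<le> p v ^ s" by simp
  qed
  let ?r = "\<lambda>n. real (n choose j) / real n ^ j"
  have M: "(\<lambda>v. ?r (p v ^ (t - 1))) \<longlonglongrightarrow> 1 / fact j"
    using t by (intro filterlim_compose[OF binomial_ratio_tendsto] pw) simp
  have N: "(\<lambda>v. ?r (p v ^ t)) \<longlonglongrightarrow> 1 / fact j"
    using t by (intro filterlim_compose[OF binomial_ratio_tendsto] pw) simp
  have "(\<lambda>v. ?r (p v ^ (t - 1)) * ?r v / ?r (p v ^ t)) \<longlonglongrightarrow> 1 / fact j * (1 / fact j) / (1 / fact j)"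
    by (intro tendsto_divide tendsto_mult M N binomial_ratio_tendsto) simp
  then have lim: "(\<lambda>v. ?r (p v ^ (t - 1)) * ?r v / ?r (p v ^ t)) \<longlonglongrightarrow> 1 / fact j" by simp
  have "\<forall>\<^sub>F v in sequentially. 1 \<le> p v" using p by (simp add: filterlim_at_top)
  with eventually_gt_at_top[of 0]
  have "\<forall>\<^sub>F v in sequentially. ?r (p v ^ (t - 1)) * ?r v / ?r (p v ^ t) =
      plane_moment t (p v) v j / (real v / real (p v)) ^ j"
  proof eventually_elim
    case (elim v)
    have "real (p v) ^ t = real (p v) * real (p v) ^ (t - 1)"
      using t by (simp flip: power_Suc)
    then have "real (p v ^ t) ^ j = real (p v) ^ j * real (p v ^ (t - 1)) ^ j"
      by (simp add: power_mult_distrib)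
    then show ?case using elim by (simp add: plane_moment_def power_divide field_simps)
  qed
  with lim show ?thesis by (rule Lim_transform_eventually)
qed

text \<open>
  The expectation of \<open>(X choose t) * (X - v / p)\<^sup>2\<close> for this number \<open>X\<close>, written in terms of the moments
  by means of \<open>binomial_mult_square_diff\<close>.
\<close>

definition plane_deviation :: "nat \<Rightarrow> nat \<Rightarrow> nat \<Rightarrow> real" where
  "plane_deviation t p v =
    real (Suc t) * real (Suc (Suc t)) * plane_moment t p v (Suc (Suc t)) +
    real (Suc t) * (2 * real t + 1 - 2 * (real v / real p)) * plane_moment t p v (Suc t) +
    (real t - real v / real p)\<^sup>2 * plane_moment t p v t"

text \<open>After normalisation the three summands tend to \<open>1 / fact t\<close>,
  \<open>- 2 / fact t\<close> and \<open>1 / fact t\<close>, which cancel.\<close>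

lemma plane_deviation_tendsto_0:
  fixes p :: "nat \<Rightarrow> nat"
  defines "\<mu> \<equiv> \<lambda>v. real v / real (p v)"
  assumes t: "2 \<le> t" and p: "filterlim p at_top sequentially" and \<mu>: "filterlim \<mu> at_top sequentially"
  shows "(\<lambda>v. plane_deviation t (p v) v / \<mu> v ^ (t + 2)) \<longlonglongrightarrow> 0"
proof -
  let ?m = "\<lambda>v j. plane_moment t (p v) v j / \<mu> v ^ j"
  have m: "(\<lambda>v. ?m v j) \<longlonglongrightarrow> 1 / fact j" for j
    unfolding \<mu>_def using plane_moment_tendsto[OF t p] .
  have inv: "(\<lambda>v. c / \<mu> v) \<longlonglongrightarrow> 0" for c
    by (intro tendsto_divide_0[OF tendsto_const] filterlim_at_top_imp_at_infinity \<mu>)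
  have "(\<lambda>v. real (Suc t) * real (Suc (Suc t)) * ?m v (Suc (Suc t)) +
      real (Suc t) * ((2 * real t + 1) / \<mu> v - 2) * ?m v (Suc t) + (real t / \<mu> v - 1)\<^sup>2 * ?m v t)
    \<longlonglongrightarrow> real (Suc t) * real (Suc (Suc t)) * (1 / fact (Suc (Suc t))) +
      real (Suc t) * (0 - 2) * (1 / fact (Suc t)) + (0 - 1)\<^sup>2 * (1 / fact t)"
    by (intro tendsto_add tendsto_mult tendsto_diff tendsto_power inv m tendsto_const)
  also have "real (Suc t) * real (Suc (Suc t)) * (1 / fact (Suc (Suc t))) +
      real (Suc t) * (0 - 2) * (1 / fact (Suc t)) + (0 - 1)\<^sup>2 * (1 / fact t) = (0::real)"
  proof -
    have "real (Suc t) * real (Suc (Suc t)) * (1 / fact (Suc (Suc t))) = (1::real) / fact t"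
      by (simp del: of_nat_Suc)
    moreover have "real (Suc t) * (0 - 2) * (1 / fact (Suc t)) = - 2 * ((1::real) / fact t)"
      by (simp del: of_nat_Suc)
    ultimately show ?thesis by simp
  qed
  finally have lim: "(\<lambda>v. real (Suc t) * real (Suc (Suc t)) * ?m v (Suc (Suc t)) +
      real (Suc t) * ((2 * real t + 1) / \<mu> v - 2) * ?m v (Suc t) + (real t / \<mu> v - 1)\<^sup>2 * ?m v t) \<longlonglongrightarrow> 0" .
  have "\<forall>\<^sub>F v in sequentially. 1 \<le> \<mu> v" using \<mu> by (simp add: filterlim_at_top)
  then have "\<forall>\<^sub>F v in sequentially. real (Suc t) * real (Suc (Suc t)) * ?m v (Suc (Suc t)) +
      real (Suc t) * ((2 * real t + 1) / \<mu> v - 2) * ?m v (Suc t) + (real t / \<mu> v - 1)\<^sup>2 * ?m v t =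
    plane_deviation t (p v) v / \<mu> v ^ (t + 2)"
  proof eventually_elim
    case (elim v)
    have "a * (A / (x * x * y)) + b * (c / x - 2) * (B / (x * y)) + (d / x - 1)\<^sup>2 * (C / y) =
        (a * A + b * (c - 2 * x) * B + (d - x)\<^sup>2 * C) / (y * x\<^sup>2)"
      if "0 < x" "0 < y" for a b c d x y A B C :: real
      using that by (simp add: field_simps power2_eq_square)
    note id = this[of "\<mu> v" "\<mu> v ^ t"]
    have eq: "real v / real (p v) = \<mu> v" by (simp add: \<mu>_def)
    show ?case
      unfolding plane_deviation_def eq using id elim
      by (simp add: power_add mult.assoc power2_eq_square)
  qed
  with lim show ?thesis by (rule Lim_transform_eventually)
qed

subsection \<open>The induced covering\<close>

text \<open>Double counting: every block contributes to exactly the \<open>k choose t\<close> sets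
  it contains.\<close>

lemma covering_density_eq:
  assumes "finite V" "\<And>B. B \<in># \<C> \<Longrightarrow> B \<in> nsets V k"
  shows "covering_density t V \<C> = real (size \<C>) * real (k choose t) / real (card V choose t)"
proof -
  have fin: "finite (nsets V t)" using assms(1) by (rule finite_imp_finite_nsets)
  have "(\<Sum>T\<in>nsets V t. real (size {#B \<in># \<C>. T \<subseteq> B#})) = real (size \<C>) * real (k choose t)"
    using assms(2)
  proof (induction \<C>)
    case (add B \<C>)
    have B: "B \<in> nsets V k" using add.prems by simp
    then have cB: "card B = k" and eq: "{T\<in>nsets V t. T \<subseteq> B} = nsets B t" by (auto simp: nsets_def)
    have "card {T\<in>nsets V t. T \<subseteq> B} = k choose t" unfolding eq card_nsets cB ..
    then have "(\<Sum>T\<in>nsets V t. if T \<subseteq> B then 1 else 0 :: real) = real (k choose t)"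
      using fin by (simp add: sum.If_cases Int_def)
    moreover have "real (size {#B' \<in># add_mset B \<C>. T \<subseteq> B'#}) =
        (if T \<subseteq> B then 1 else 0) + real (size {#B' \<in># \<C>. T \<subseteq> B'#})" for T by simp
    ultimately have "(\<Sum>T\<in>nsets V t. real (size {#B' \<in># add_mset B \<C>. T \<subseteq> B'#})) =
        real (k choose t) + (\<Sum>T\<in>nsets V t. real (size {#B' \<in># \<C>. T \<subseteq> B'#}))"
      by (simp only: sum.distrib)
    then show ?case using add by (simp add: algebra_simps)
  qed simp
  then show ?thesis unfolding covering_density_def by simp
qed

lemma covering_density_ge_1:
  assumes "finite V" "t \<le> card V" "\<And>T. T \<in> nsets V t \<Longrightarrow> \<exists>B\<in>#\<C>. T \<subseteq> B"
  shows "1 \<le> covering_density t V \<C>"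
proof -
  have "1 \<le> real (size {#B \<in># \<C>. T \<subseteq> B#})" if T: "T \<in> nsets V t" for T
  proof -
    obtain B where "B \<in># \<C>" "T \<subseteq> B" using assms(3)[OF T] by blast
    then have "B \<in># {#B \<in># \<C>. T \<subseteq> B#}" by simp
    then have "size {#B \<in># \<C>. T \<subseteq> B#} \<noteq> 0" by (metis empty_iff set_mset_empty size_eq_0_iff_empty)
    then show ?thesis by linarith
  qed
  then have "real (card (nsets V t)) * 1 \<le> (\<Sum>T\<in>nsets V t. real (size {#B \<in># \<C>. T \<subseteq> B#}))"
    by (rule sum_bounded_below)
  moreover have "0 < card (nsets V t)" using assms(2) by simp
  ultimately show ?thesis unfolding covering_density_def by (simp add: le_divide_eq)
qed

section \<open>Coverings produced by the stages of the algorithm\<close>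

definition is_covering :: "nat \<Rightarrow> nat \<Rightarrow> 'a set \<Rightarrow> 'a set multiset \<Rightarrow> bool" where
  "is_covering k t X \<B> \<longleftrightarrow> (\<forall>B. B \<in># \<B> \<longrightarrow> B \<in> nsets X k) \<and> (\<forall>T\<in>nsets X t. \<exists>B\<in>#\<B>. T \<subseteq> B)"

lemma greedy_resultD:
  assumes res: "greedy_result X k t xs \<B>" and X: "finite X" and xs: "set xs \<subseteq> nsets X k" and tk: "t \<le> k"
  shows "is_covering k t X \<B>" "size \<B> = greedy_size t X xs"
proof -
  have "nsets B t \<noteq> {}" if "B \<in> set xs" for B
  proof -
    have "t \<le> card B" using that tk xs by (auto simp: nsets_def)
    then obtain T where "T \<subseteq> B" "card T = t" "finite T" by (rule obtain_subset_with_card_n)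
    then show ?thesis by (auto simp: nsets_def)
  qed
  then have gp: "greedy_packing t xs = greedy t xs" by (rule greedy_packing_eq_greedy)
  define U where "U = {T \<in> nsets X t. \<not> covered (greedy t xs) T}"
  obtain f where f0: "\<forall>T\<in>nsets X t. f T \<in> nsets X k \<and> T \<subseteq> f T"
    and B: "\<B> = mset_set (greedy t xs) + image_mset f (mset_set U)"
    using res unfolding greedy_result_def gp U_def[symmetric] by (elim exE conjE) (rule that)
  note f = f0[rule_format]
  have fin: "finite (greedy t xs)" by (rule finite_subset[OF greedy_subset finite_set])
  have finU: "finite U" unfolding U_def using finite_imp_finite_nsets[OF X, of t] by simp
  have mem: "B \<in># \<B> \<longleftrightarrow> B \<in> greedy t xs \<or> B \<in> f ` U" for B
    unfolding B using fin finU by auto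
  show "size \<B> = greedy_size t X xs" unfolding B greedy_size_def U_def by simp
  have "B \<in> nsets X k" if "B \<in># \<B>" for B
  proof -
    have "B \<in> greedy t xs \<or> (\<exists>T\<in>U. B = f T)" using that unfolding mem by blast
    then show ?thesis
    proof
      assume "B \<in> greedy t xs" then show ?thesis using greedy_subset xs by blast
    next
      assume "\<exists>T\<in>U. B = f T" then show ?thesis using f unfolding U_def by blast
    qed
  qed
  moreover have "\<exists>B\<in>#\<B>. T \<subseteq> B" if T: "T \<in> nsets X t" for T
  proof (cases "covered (greedy t xs) T")
    case True
    then obtain B where "B \<in> greedy t xs" "T \<subseteq> B" unfolding covered_def by blast
    then show ?thesis using mem by blast
  next
    case False
    then have "f T \<in># \<B>" using T unfolding mem U_def by blast
    then show ?thesis using f[OF T] by blast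
  qed
  ultimately show "is_covering k t X \<B>" unfolding is_covering_def by blast
qed

text \<open>Run 0 is the one compared with, so that the size bound depends on a single uniformly
  random ordering.\<close>

lemma best_greedy_resultD:
  assumes res: "best_greedy_result n k t r xss \<B>" and tk: "t \<le> k"
    and xss: "\<And>i. i < r \<Longrightarrow> set (xss i) \<subseteq> nsets {..<n} k"
  shows "is_covering k t {..<n} \<B>" "size \<B> \<le> greedy_size t {..<n} (xss 0)"
proof -
  obtain runs i where runs0: "\<forall>i<r. greedy_result {..<n} k t (xss i) (runs i)"
    and i0: "i < r" "\<B> = runs i" "\<forall>j<r. size (runs i) \<le> size (runs j)"
    using res unfolding best_greedy_result_def by (elim exE conjE) (rule that)
  note runs = runs0[rule_format] and i = i0[rule_format]
  have fin: "finite {..<n}" by simp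
  show "is_covering k t {..<n} \<B>"
    unfolding i(2) by (rule greedy_resultD[OF runs[OF i(1)] fin xss[OF i(1)] tk])
  have r: "0 < r" using i(1) by simp
  have "size \<B> \<le> size (runs 0)" unfolding i(2) using i(3)[OF r] .
  also have "\<dots> = greedy_size t {..<n} (xss 0)"
    by (rule greedy_resultD[OF runs[OF r] fin xss[OF r] tk])
  finally show "size \<B> \<le> greedy_size t {..<n} (xss 0)" .
qed

lemma is_covering_image:
  assumes cov: "is_covering k t X \<B>" and bij: "bij_betw \<phi> X S"
  shows "is_covering k t S (image_mset (image \<phi>) \<B>)"
proof -
  have inj: "inj_on \<phi> X" and S: "\<phi> ` X = S" using bij by (auto simp: bij_betw_def)
  have img: "\<phi> ` B \<in> nsets S k" if B: "B \<in> nsets X k" for B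
  proof -
    have B: "B \<subseteq> X" "finite B" "card B = k" using B by (auto simp: nsets_def)
    then have "card (\<phi> ` B) = k" using card_image inj_on_subset[OF inj] by metis
    then show ?thesis using B S by (auto simp: nsets_def)
  qed
  have "\<exists>B\<in>#image_mset (image \<phi>) \<B>. T \<subseteq> B" if T: "T \<in> nsets S t" for T
  proof -
    have T: "T \<subseteq> S" "finite T" "card T = t" using T by (auto simp: nsets_def)
    obtain U where U: "U \<subseteq> X" "T = \<phi> ` U" using T(1) S by (metis subset_imageE)
    have "card U = t" using T(3) U card_image inj_on_subset[OF inj U(1)] by metis
    moreover have "finite U" using T(2) U finite_imageD inj_on_subset[OF inj U(1)] by metis
    ultimately have "U \<in> nsets X t" using U(1) by (simp add: nsets_def)
    then obtain B where "B \<in># \<B>" "U \<subseteq> B" using cov unfolding is_covering_def by blast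
    then show ?thesis unfolding U(2) by (auto intro!: bexI[of _ "\<phi> ` B"])
  qed
  moreover have "B \<in> nsets S k" if "B \<in># image_mset (image \<phi>) \<B>" for B
    using that img cov unfolding is_covering_def by auto
  ultimately show ?thesis unfolding is_covering_def by blast
qed

lemma hyperplane_blocksD:
  assumes res: "hyperplane_blocks k t v P V H \<B>" and V: "finite V"
    and P: "\<And>l. medium t v l \<Longrightarrow> is_covering k t {..<l} (P l)"
  shows "\<And>B. B \<in># \<B> \<Longrightarrow> B \<in> nsets V k"
    and "\<And>T. T \<in> nsets (H \<inter> V) t \<Longrightarrow> \<exists>B\<in>#\<B>. T \<subseteq> B"
    and "size \<B> = (if medium t v (card (H \<inter> V)) then size (P (card (H \<inter> V))) else card (H \<inter> V) choose t)"
proof -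
  let ?S = "H \<inter> V"
  have "(\<forall>B. B \<in># \<B> \<longrightarrow> B \<in> nsets V k) \<and> (\<forall>T\<in>nsets ?S t. \<exists>B\<in>#\<B>. T \<subseteq> B) \<and>
    size \<B> = (if medium t v (card ?S) then size (P (card ?S)) else card ?S choose t)"
  proof (cases "medium t v (card ?S)")
    case True
    then obtain \<phi> where \<phi>: "bij_betw \<phi> {..<card ?S} ?S" "\<B> = image_mset (image \<phi>) (P (card ?S))"
      using res unfolding hyperplane_blocks_def Let_def by auto
    have "is_covering k t ?S \<B>" unfolding \<phi>(2) by (rule is_covering_image[OF P[OF True] \<phi>(1)])
    moreover have "nsets ?S k \<subseteq> nsets V k" by (rule nsets_mono) blast
    ultimately show ?thesis using True unfolding is_covering_def by (auto simp: \<phi>(2))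
  next
    case False
    then obtain f where f: "\<And>T. T \<in> nsets ?S t \<Longrightarrow> f T \<in> nsets V k \<and> T \<subseteq> f T"
      "\<B> = image_mset f (mset_set (nsets ?S t))"
      using res unfolding hyperplane_blocks_def Let_def by auto
    have "finite (nsets ?S t)" using V by (intro finite_imp_finite_nsets) simp
    then show ?thesis using False f(1) unfolding f(2) by auto
  qed
  then show "\<And>B. B \<in># \<B> \<Longrightarrow> B \<in> nsets V k" "\<And>T. T \<in> nsets ?S t \<Longrightarrow> \<exists>B\<in>#\<B>. T \<subseteq> B"
    "size \<B> = (if medium t v (card ?S) then size (P (card ?S)) else card ?S choose t)"
    by blast+
qed

text \<open>A bound for the blocks contributed by \<open>H\<close> that depends on the random input
  only, not on the choices the algorithm leaves open; run 0 stands in for the best run.\<close>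

definition induced_size_bound :: "nat \<Rightarrow> nat \<Rightarrow> nat \<Rightarrow> (nat \<times> nat \<Rightarrow> nat set list) \<Rightarrow> point set \<Rightarrow> point set \<Rightarrow> nat" where
  "induced_size_bound t p v \<omega> V H = (let l = card (H \<inter> V) in
     if medium t v l then greedy_size t {..<l} (\<omega> (l, 0)) else l choose t)"

text \<open>Both bounds hold for every admissible way of making the open choices. The lower one uses
  that each \<open>t\<close>-subset of \<open>V\<close> lies on some hyperplane, the upper one adds
  up the contributions of the hyperplanes.\<close>

lemma induced_result_density:
  assumes res: "induced_result k t p r v \<omega> V \<C>" and V: "V \<in> nsets (AG t p) v" and p: "prime p"
    and t: "0 < t" "t \<le> k" "t \<le> v"
    and \<omega>: "\<And>l i. medium t v l \<Longrightarrow> i < r \<Longrightarrow> \<omega> (l, i) \<in> permutations_of_set (nsets {..<l} k)"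
  shows "1 \<le> covering_density t V \<C>"
    and "covering_density t V \<C> \<le> real (k choose t) / real (v choose t) *
      (\<Sum>H\<in>hyperplanes t p. real (induced_size_bound t p v \<omega> V H))"
proof -
  have V: "V \<subseteq> AG t p" "finite V" "card V = v" using V by (auto simp: nsets_def)
  obtain P Q where P0: "\<forall>l. medium t v l \<longrightarrow> best_greedy_result l k t r (\<lambda>i. \<omega> (l, i)) (P l)"
    and Q0: "\<forall>H\<in>hyperplanes t p. hyperplane_blocks k t v P V H (Q H)"
    and C: "\<C> = (\<Sum>H\<in>hyperplanes t p. Q H)"
    using res unfolding induced_result_def by (elim exE conjE) (rule that)
  note P = P0[rule_format] and Q = Q0[rule_format]
  have perm: "set (\<omega> (l, i)) \<subseteq> nsets {..<l} k" if "medium t v l" "i < r" for l i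
    using \<omega>[OF that] by (simp add: permutations_of_set_def)
  have Pl: "is_covering k t {..<l} (P l)" "size (P l) \<le> greedy_size t {..<l} (\<omega> (l, 0))"
    if "medium t v l" for l
    using best_greedy_resultD[OF P[OF that] t(2) perm[OF that]] by auto
  note QD = hyperplane_blocksD[OF Q V(2) Pl(1)]
  have mem: "B \<in># \<C> \<longleftrightarrow> (\<exists>H\<in>hyperplanes t p. B \<in># Q H)" for B
    unfolding C by (simp add: set_mset_sum)
  show "1 \<le> covering_density t V \<C>"
  proof (rule covering_density_ge_1)
    fix T assume T: "T \<in> nsets V t"
    then have TA: "T \<in> nsets (AG t p) t" using nsets_mono[OF V(1), of t] by (rule subsetD[rotated])
    obtain H where H: "H \<in> hyperplanes t p" "T \<subseteq> H"
      using nsets_AG_subset_hyperplane[OF p t(1) TA] by (elim bexE) (rule that)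
    then have "T \<in> nsets (H \<inter> V) t" using T by (auto simp: nsets_def)
    from QD(2)[OF H(1) _ this] show "\<exists>B\<in>#\<C>. T \<subseteq> B" using mem H(1) by blast
  qed (use V t in auto)
  have eq: "covering_density t V \<C> = real (size \<C>) * real (k choose t) / real (card V choose t)"
  proof (rule covering_density_eq[OF V(2)])
    fix B assume "B \<in># \<C>"
    then obtain H where H: "H \<in> hyperplanes t p" "B \<in># Q H" unfolding mem by (elim bexE) (rule that)
    show "B \<in> nsets V k" by (rule QD(1)[OF H(1) _ H(2)])
  qed
  have "size \<C> \<le> (\<Sum>H\<in>hyperplanes t p. induced_size_bound t p v \<omega> V H)"
    unfolding C size_multiset_sum
  proof (rule sum_mono)
    fix H assume H: "H \<in> hyperplanes t p"
    show "size (Q H) \<le> induced_size_bound t p v \<omega> V H"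
      using QD(3)[OF H] Pl(2)[of "card (H \<inter> V)"] unfolding induced_size_bound_def Let_def by simp
  qed
  then have "real (size \<C>) \<le> (\<Sum>H\<in>hyperplanes t p. real (induced_size_bound t p v \<omega> V H))"
    by (simp flip: of_nat_sum)
  then have "real (k choose t) / real (v choose t) * real (size \<C>) \<le> real (k choose t) / real (v choose t) *
      (\<Sum>H\<in>hyperplanes t p. real (induced_size_bound t p v \<omega> V H))"
    by (intro mult_left_mono) auto
  then show "covering_density t V \<C> \<le> real (k choose t) / real (v choose t) *
      (\<Sum>H\<in>hyperplanes t p. real (induced_size_bound t p v \<omega> V H))"
    unfolding eq V(3) by (simp add: mult.commute)
qed

section \<open>Expectations under couplings and over independent inputs\<close>

lemma rel_pmf_expectation_bounds:
  fixes g :: "'b \<Rightarrow> real" and Z :: "'a \<Rightarrow> real"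
  assumes rel: "rel_pmf R A D" and fin: "finite (set_pmf A)"
    and bd: "\<And>x y. x \<in> set_pmf A \<Longrightarrow> R x y \<Longrightarrow> l \<le> g y \<and> g y \<le> Z x"
  shows "l \<le> measure_pmf.expectation D g" "measure_pmf.expectation D g \<le> measure_pmf.expectation A Z"
proof -
  obtain pq where pq: "\<And>x y. (x, y) \<in> set_pmf pq \<Longrightarrow> R x y" "map_pmf fst pq = A" "map_pmf snd pq = D"
    using rel by (auto elim: rel_pmf.cases)
  have mem: "fst z \<in> set_pmf A" if "z \<in> set_pmf pq" for z
    unfolding pq(2)[symmetric] set_map_pmf using that by (rule imageI)
  have bd': "l \<le> g (snd z)" "g (snd z) \<le> Z (fst z)" if "z \<in> set_pmf pq" for z
    using bd[OF mem[OF that], of "snd z"] pq(1)[of "fst z" "snd z"] that by simp_all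
  \<comment> \<open>A nonintegrable function has expectation 0 by convention, so integrability must
    be secured first. On the coupling \<open>g\<close> lies between \<open>l\<close> and
    \<open>Z\<close>, and \<open>Z\<close> is bounded by \<open>b\<close> on the finite support of
    \<open>A\<close>.\<close>
  define b where "b = (\<Sum>x\<in>set_pmf A. \<bar>Z x\<bar>)"
  have Zb: "\<bar>Z x\<bar> \<le> b" if "x \<in> set_pmf A" for x
    unfolding b_def using that fin by (intro member_le_sum) auto
  have intZ: "integrable (measure_pmf pq) (\<lambda>z. Z (fst z))"
  proof (rule measure_pmf.integrable_const_bound)
    show "AE z in measure_pmf pq. norm (Z (fst z)) \<le> b" using Zb mem by (intro AE_pmfI) simp
  qed simp
  have intg: "integrable (measure_pmf pq) (\<lambda>z. g (snd z))"
  proof (rule measure_pmf.integrable_const_bound)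
    show "AE z in measure_pmf pq. norm (g (snd z)) \<le> \<bar>l\<bar> + b"
    proof (rule AE_pmfI)
      fix z assume z: "z \<in> set_pmf pq"
      have "\<bar>Z (fst z)\<bar> \<le> b" using Zb[OF mem[OF z]] .
      then show "norm (g (snd z)) \<le> \<bar>l\<bar> + b" using bd'[OF z] unfolding real_norm_def by linarith
    qed
  qed simp
  have eD: "measure_pmf.expectation D g = measure_pmf.expectation pq (\<lambda>z. g (snd z))"
    unfolding pq(3)[symmetric] by simp
  have eA: "measure_pmf.expectation A Z = measure_pmf.expectation pq (\<lambda>z. Z (fst z))"
    unfolding pq(2)[symmetric] by simp
  have "measure_pmf.expectation pq (\<lambda>z. l) \<le> measure_pmf.expectation pq (\<lambda>z. g (snd z))"
    by (rule integral_mono_AE[OF _ intg]) (use bd' in \<open>auto intro: AE_pmfI\<close>)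
  then show "l \<le> measure_pmf.expectation D g" unfolding eD by simp
  show "measure_pmf.expectation D g \<le> measure_pmf.expectation A Z"
    unfolding eD eA by (rule integral_mono_AE[OF intg intZ], rule AE_pmfI, rule bd'(2))
qed

lemma expectation_pair_pmf_swap:
  fixes f :: "'a \<times> 'b \<Rightarrow> real"
  assumes A: "finite (set_pmf A)" and B: "finite (set_pmf B)"
  shows "measure_pmf.expectation (pair_pmf A B) f =
    measure_pmf.expectation B (\<lambda>y. measure_pmf.expectation A (\<lambda>x. f (x, y)))"
proof -
  have "measure_pmf.expectation (pair_pmf A B) f = (\<Sum>z\<in>set_pmf A \<times> set_pmf B. f z * pmf (pair_pmf A B) z)"
    using A B by (intro integral_measure_pmf_real) auto
  also have "\<dots> = (\<Sum>x\<in>set_pmf A. \<Sum>y\<in>set_pmf B. f (x, y) * (pmf A x * pmf B y))"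
    unfolding sum.cartesian_product by (intro sum.cong refl) (auto simp: pmf_pair)
  also have "\<dots> = (\<Sum>y\<in>set_pmf B. \<Sum>x\<in>set_pmf A. f (x, y) * (pmf A x * pmf B y))"
    by (rule sum.swap)
  also have "\<dots> = (\<Sum>y\<in>set_pmf B. (\<Sum>x\<in>set_pmf A. f (x, y) * pmf A x) * pmf B y)"
    by (simp add: sum_distrib_right mult.assoc)
  also have "\<dots> = (\<Sum>y\<in>set_pmf B. measure_pmf.expectation A (\<lambda>x. f (x, y)) * pmf B y)"
  proof (rule sum.cong[OF refl])
    fix y
    have "measure_pmf.expectation A (\<lambda>x. f (x, y)) = (\<Sum>x\<in>set_pmf A. f (x, y) * pmf A x)"
      using A by (intro integral_measure_pmf_real) auto
    then show "(\<Sum>x\<in>set_pmf A. f (x, y) * pmf A x) * pmf B y = measure_pmf.expectation A (\<lambda>x. f (x, y)) * pmf B y"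
      by simp
  qed
  also have "\<dots> = measure_pmf.expectation B (\<lambda>y. measure_pmf.expectation A (\<lambda>x. f (x, y)))"
    using B by (intro integral_measure_pmf_real[symmetric]) auto
  finally show ?thesis .
qed

section \<open>The choice of the prime and typical intersection sizes\<close>

lemma finite_medium: "finite {l. medium t v l}"
proof (rule finite_subset)
  show "{l. medium t v l} \<subseteq> {..nat \<lceil>9 * ell t v\<rceil>}"
  proof
    fix l assume "l \<in> {l. medium t v l}"
    then have "real l < 9 * ell t v" by (simp add: medium_def)
    then show "l \<in> {..nat \<lceil>9 * ell t v\<rceil>}" by simp linarith
  qed
qed simp

lemma filterlim_ell_at_top:
  assumes "2 \<le> t"
  shows "filterlim (ell t) at_top sequentially"
proof -
  have e: "0 < 1 - 1 / real t" using assms by simp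
  have "filterlim (\<lambda>v. real v powr (1 - 1 / real t)) at_top sequentially"
    using e by real_asymp
  then show ?thesis unfolding ell_def[abs_def]
    by (intro filterlim_tendsto_pos_mult_at_top[OF tendsto_const]) auto
qed

text \<open>The condition \<open>18 * t \<le> v\<close> makes \<open>v - t\<close> at least
  \<open>17 / 18 * v\<close>, so the bounds on \<open>(v - t) / p\<close> carry over to the mean
  \<open>v / p\<close> almost unchanged.\<close>

lemma prime_choice_bounds:
  assumes t: "2 \<le> t" and v: "18 * t \<le> v" and pc: "prime_choice t v p"
  shows "real v powr (1 / real t) \<le> real p" "v \<le> p ^ t" "4 * ell t v \<le> real v / real p"
    and "\<And>l. \<not> medium t v l \<Longrightarrow> (real v / real p)\<^sup>2 \<le> 256 * (real l - real v / real p)\<^sup>2"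
proof -
  have v0: "0 < real v" and tv: "real v - real t \<ge> 17 / 18 * real v" using t v by simp_all
  have p0: "0 < real p" using pc prime_gt_0_nat unfolding prime_choice_def by simp
  have lo: "4 * ell t v \<le> (real v - real t) / real p" and hi: "(real v - real t) / real p \<le> 8 * ell t v"
    using pc unfolding prime_choice_def by auto
  have split: "real v powr (1 - 1 / real t) * real v powr (1 / real t) = real v"
    using v0 by (simp flip: powr_add)
  let ?w = "real v powr (1 - 1 / real t)"
  have w0: "0 < ?w" using v0 by simp
  \<comment> \<open>Writing \<open>v\<close> as the product in \<open>split\<close> gives
    \<open>p\<close> at least 17/16 times the \<open>t\<close>-th root of \<open>v\<close>.\<close>
  have "17 / 18 * real v \<le> 8 * ell t v * real p"
    using hi tv p0 by (simp add: divide_le_eq)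
  then have "17 / 18 * (?w * real v powr (1 / real t)) \<le> 8 / 9 * ?w * real p"
    unfolding split by (simp add: ell_def)
  then have "?w * real v powr (1 / real t) \<le> ?w * real p"
    using mult_nonneg_nonneg[of ?w "real v powr (1 / real t)"] w0 by simp
  then show pv: "real v powr (1 / real t) \<le> real p" using w0 by simp
  have "(real v powr (1 / real t)) ^ t = real v"
    using v0 t by (simp add: powr_realpow[symmetric] powr_powr)
  moreover have "(real v powr (1 / real t)) ^ t \<le> real p ^ t" using pv by (intro power_mono) auto
  ultimately have "real v \<le> real (p ^ t)" by simp
  then show "v \<le> p ^ t" by linarith
  define \<mu> where "\<mu> = real v / real p"
  have \<mu>0: "0 < \<mu>" unfolding \<mu>_def using v0 p0 by simp
  have up: "(real v - real t) / real p \<le> \<mu>" unfolding \<mu>_def using p0 by (intro divide_right_mono) auto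
  have down: "17 / 18 * \<mu> \<le> (real v - real t) / real p"
    unfolding \<mu>_def times_divide_eq_right using tv p0 by (intro divide_right_mono) auto
  show "4 * ell t v \<le> real v / real p" using lo up unfolding \<mu>_def by linarith
  fix l assume "\<not> medium t v l"
  then have "real l \<le> ell t v \<or> 9 * ell t v \<le> real l" unfolding medium_def by linarith
  \<comment> \<open>A small \<open>l\<close> is at most \<mu>/4. A large one is at least 9/8 * 17/18
    = 17/16 times \<mu>. Either way the deviation is at least \<mu>/16, and 256 is the square of
    16.\<close>
  then have "\<mu> \<le> 16 * \<bar>real l - \<mu>\<bar>"
  proof
    assume "real l \<le> ell t v"
    moreover have "\<mu> - real l \<le> \<bar>real l - \<mu>\<bar>" by simp
    ultimately show ?thesis using lo up \<mu>0 by argo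
  next
    assume "9 * ell t v \<le> real l"
    moreover have "real l - \<mu> \<le> \<bar>real l - \<mu>\<bar>" by simp
    ultimately show ?thesis using hi down \<mu>0 by argo
  qed
  then have "\<mu>\<^sup>2 \<le> (16 * \<bar>real l - \<mu>\<bar>)\<^sup>2" using \<mu>0 by (intro power_mono) auto
  then show "(real v / real p)\<^sup>2 \<le> 256 * (real l - real v / real p)\<^sup>2"
    unfolding \<mu>_def[symmetric] by (simp add: power_mult_distrib)
qed

text \<open>
  Hyperplanes with an atypical number of points are paid for by Chebyshev's inequality, hence the
  second summand.
\<close>

lemma expectation_induced_size_bound:
  assumes t: "2 \<le> t" "t \<le> k" and v: "18 * t \<le> v" and pc: "prime_choice t v p" and r: "1 \<le> r"
    and greedy: "\<And>l. medium t v l \<Longrightarrow>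
      measure_pmf.expectation (pmf_of_set (permutations_of_set (nsets {..<l} k))) (\<lambda>xs. real (greedy_size t {..<l} xs))
      \<le> c * real (l choose t)" and c: "0 \<le> c"
    and H: "H \<in> hyperplanes t p"
  shows "measure_pmf.expectation (random_input k t p r v) (\<lambda>(\<omega>, V). real (induced_size_bound t p v \<omega> V H))
    \<le> c * plane_moment t p v t + 256 / (real v / real p)\<^sup>2 * plane_deviation t p v"
proof -
  define \<mu> where "\<mu> = real v / real p"
  define W where "W = Pi_pmf ({l. medium t v l} \<times> {..<r}) []
          (\<lambda>(l, i). pmf_of_set (permutations_of_set (nsets {..<l} k)))"
  define U where "U = pmf_of_set (nsets (AG t p) v)"
  note pb = prime_choice_bounds[OF t(1) v pc]
  have p: "prime p" using pc by (simp add: prime_choice_def)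
  have "0 < v" using v t by simp
  have p0: "0 < real p" using p prime_gt_0_nat by simp
  have \<mu>0: "0 < \<mu>" unfolding \<mu>_def using \<open>0 < v\<close> p0 by simp
  have finI: "finite ({l. medium t v l} \<times> {..<r})" using finite_medium by simp
  have finW: "finite (set_pmf W)"
    unfolding W_def set_Pi_pmf[OF finI] by (rule finite_PiE_dflt[OF finI]) (auto simp: set_pmf_random_order)
  have finN: "finite (nsets (AG t p) v)" by (rule finite_imp_finite_nsets) simp
  have "0 < card (nsets (AG t p) v)" using pb(2) by simp
  then have neN: "nsets (AG t p) v \<noteq> {}" by (metis card.empty less_irrefl)
  have sU: "set_pmf U = nsets (AG t p) v" unfolding U_def by (rule set_pmf_of_set[OF neN finN])
  have finU: "finite (set_pmf U)" unfolding sU by (rule finN)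
  have intU: "integrable (measure_pmf U) f" for f :: "_ \<Rightarrow> real"
    by (rule integrable_measure_pmf_finite[OF finU])
  have inner: "measure_pmf.expectation W (\<lambda>\<omega>. real (induced_size_bound t p v \<omega> V H))
      \<le> c * real (card (H \<inter> V) choose t) +
        256 / \<mu>\<^sup>2 * (real (card (H \<inter> V) choose t) * (real (card (H \<inter> V)) - \<mu>)\<^sup>2)" for V
  proof (cases "medium t v (card (H \<inter> V))")
    case True
    define l where "l = card (H \<inter> V)"
    have m: "(l, 0) \<in> {l. medium t v l} \<times> {..<r}" using True r unfolding l_def by simp
    \<comment> \<open>Since \<open>1 \<le> r\<close>, the index \<open>(l, 0)\<close> belongs to the
      product, so its marginal is a uniformly random ordering and not the default
      \<open>[]\<close>.\<close>
    have map: "map_pmf (\<lambda>\<omega>. \<omega> (l, 0)) W = pmf_of_set (permutations_of_set (nsets {..<l} k))"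
      unfolding W_def by (subst Pi_pmf_component[OF finI]) (use m in simp)
    have "measure_pmf.expectation W (\<lambda>\<omega>. real (induced_size_bound t p v \<omega> V H)) =
        measure_pmf.expectation W (\<lambda>\<omega>. real (greedy_size t {..<l} (\<omega> (l, 0))))"
      using True unfolding induced_size_bound_def Let_def l_def by simp
    also have "\<dots> = measure_pmf.expectation (map_pmf (\<lambda>\<omega>. \<omega> (l, 0)) W) (\<lambda>xs. real (greedy_size t {..<l} xs))"
      by simp
    also have "\<dots> \<le> c * real (l choose t)" unfolding map using True unfolding l_def by (rule greedy)
    finally show ?thesis unfolding l_def by (simp add: add_increasing2)
  next
    case False
    define l where "l = card (H \<inter> V)"
    have "measure_pmf.expectation W (\<lambda>\<omega>. real (induced_size_bound t p v \<omega> V H)) = real (l choose t) * 1"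
      using False unfolding induced_size_bound_def Let_def l_def by simp
    \<comment> \<open>For sizes that are not medium the factor 1 is dominated by the scaled squared
      deviation, whose weighted expectation is computable.\<close>
    also have "\<dots> \<le> real (l choose t) * (256 / \<mu>\<^sup>2 * (real l - \<mu>)\<^sup>2)"
      using pb(4)[OF False] \<mu>0 unfolding \<mu>_def[symmetric] l_def[symmetric]
      by (intro mult_left_mono) (simp_all add: le_divide_eq)
    also have "\<dots> \<le> c * real (l choose t) + 256 / \<mu>\<^sup>2 * (real (l choose t) * (real l - \<mu>)\<^sup>2)"
      using c by (simp add: algebra_simps)
    finally show ?thesis unfolding l_def .
  qed
  have mom: "measure_pmf.expectation U (\<lambda>V. real (card (H \<inter> V) choose j)) = plane_moment t p v j" if "j \<le> v" for j
    unfolding U_def plane_moment_def using that pb(2) card_hyperplane[OF p H]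
      expectation_binomial_card_Int[OF finite_AG hyperplane_subset[OF H], of v j] by simp
  have tv: "t \<le> v" "Suc t \<le> v" "Suc (Suc t) \<le> v" using v t by linarith+
  have "measure_pmf.expectation (random_input k t p r v) (\<lambda>(\<omega>, V). real (induced_size_bound t p v \<omega> V H)) =
      measure_pmf.expectation U (\<lambda>V. measure_pmf.expectation W (\<lambda>\<omega>. real (induced_size_bound t p v \<omega> V H)))"
    unfolding random_input_def W_def[symmetric] U_def[symmetric]
    by (subst expectation_pair_pmf_swap[OF finW finU]) simp
  also have "\<dots> \<le> measure_pmf.expectation U (\<lambda>V. c * real (card (H \<inter> V) choose t) +
        256 / \<mu>\<^sup>2 * (real (card (H \<inter> V) choose t) * (real (card (H \<inter> V)) - \<mu>)\<^sup>2))"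
    by (rule integral_mono[OF intU intU inner])
  also have "\<dots> = c * measure_pmf.expectation U (\<lambda>V. real (card (H \<inter> V) choose t)) +
        256 / \<mu>\<^sup>2 * measure_pmf.expectation U (\<lambda>V. real (card (H \<inter> V) choose t) * (real (card (H \<inter> V)) - \<mu>)\<^sup>2)"
    by (simp add: intU Bochner_Integration.integral_add)
  also have "measure_pmf.expectation U (\<lambda>V. real (card (H \<inter> V) choose t) * (real (card (H \<inter> V)) - \<mu>)\<^sup>2) =
      real (Suc t) * real (Suc (Suc t)) * measure_pmf.expectation U (\<lambda>V. real (card (H \<inter> V) choose Suc (Suc t))) +
      real (Suc t) * (2 * real t + 1 - 2 * \<mu>) * measure_pmf.expectation U (\<lambda>V. real (card (H \<inter> V) choose Suc t)) +
      (real t - \<mu>)\<^sup>2 * measure_pmf.expectation U (\<lambda>V. real (card (H \<inter> V) choose t))"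
    unfolding binomial_mult_square_diff by (simp add: intU Bochner_Integration.integral_add del: of_nat_Suc)
  also have "\<dots> = plane_deviation t p v"
    unfolding plane_deviation_def \<mu>_def[symmetric] using mom tv by simp
  finally show ?thesis using mom[OF tv(1)] unfolding \<mu>_def by simp
qed

text \<open>The pointwise bounds pass through the coupling. By linearity the upper one is a sum over
  hyperplanes with a common bound, and \<open>card_hyperplanes_le\<close> limits the number of
  summands.\<close>

lemma expectation_density_bounds:
  assumes t: "2 \<le> t" "t \<le> k" and v: "18 * t \<le> v" and pc: "prime_choice t v p" and r: "1 \<le> r"
    and greedy: "\<And>l. medium t v l \<Longrightarrow>
      measure_pmf.expectation (pmf_of_set (permutations_of_set (nsets {..<l} k))) (\<lambda>xs. real (greedy_size t {..<l} xs))
      \<le> c * real (l choose t)" and c: "0 \<le> c"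
    and D: "induced_algorithm k t p r v D"
  shows "1 \<le> measure_pmf.expectation D (\<lambda>(V, \<C>). covering_density t V \<C>)"
    and "measure_pmf.expectation D (\<lambda>(V, \<C>). covering_density t V \<C>) \<le>
      real (k choose t) / real (v choose t) * (real (p ^ t) * (real p / (real p - 1)) *
        (c * plane_moment t p v t + 256 / (real v / real p)\<^sup>2 * plane_deviation t p v))"
proof -
  let ?A = "random_input k t p r v"
  let ?Z = "\<lambda>(\<omega>, V). real (k choose t) / real (v choose t) * (\<Sum>H\<in>hyperplanes t p. real (induced_size_bound t p v \<omega> V H))"
  let ?b = "c * plane_moment t p v t + 256 / (real v / real p)\<^sup>2 * plane_deviation t p v"
  note pb = prime_choice_bounds[OF t(1) v pc]
  have p: "prime p" using pc by (simp add: prime_choice_def)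
  have finI: "finite ({l. medium t v l} \<times> {..<r})" using finite_medium by simp
  have finN: "finite (nsets (AG t p) v)" by (rule finite_imp_finite_nsets) simp
  have "0 < card (nsets (AG t p) v)" using pb(2) by simp
  then have neN: "nsets (AG t p) v \<noteq> {}" by (metis card.empty less_irrefl)
  have sA: "set_pmf ?A = PiE_dflt ({l. medium t v l} \<times> {..<r}) []
      (set_pmf \<circ> (\<lambda>(l, i). pmf_of_set (permutations_of_set (nsets {..<l} k)))) \<times> nsets (AG t p) v"
    unfolding random_input_def set_pair_pmf set_Pi_pmf[OF finI] set_pmf_of_set[OF neN finN] ..
  have fA: "finite (set_pmf ?A)"
    unfolding sA using finN by (intro finite_cartesian_product finite_PiE_dflt[OF finI]) (auto simp: set_pmf_random_order)
  have int: "integrable (measure_pmf ?A) f" for f :: "_ \<Rightarrow> real"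
    by (rule integrable_measure_pmf_finite[OF fA])
  have rel: "rel_pmf (\<lambda>(\<omega>, V) (V', \<C>). V' = V \<and> induced_result k t p r v \<omega> V \<C>) ?A D"
    using D unfolding induced_algorithm_def .
  have bd: "1 \<le> (\<lambda>(V, \<C>). covering_density t V \<C>) y \<and> (\<lambda>(V, \<C>). covering_density t V \<C>) y \<le> ?Z x"
    if x: "x \<in> set_pmf ?A" and R: "(\<lambda>(\<omega>, V) (V', \<C>). V' = V \<and> induced_result k t p r v \<omega> V \<C>) x y" for x y
  proof -
    obtain \<omega> V where x_eq: "x = (\<omega>, V)" by (cases x)
    obtain \<C> where y_eq: "y = (V, \<C>)" and res: "induced_result k t p r v \<omega> V \<C>"
      using R unfolding x_eq by (cases y) auto
    have V: "V \<in> nsets (AG t p) v" using x unfolding sA x_eq by simp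
    have "\<omega> (l, i) \<in> permutations_of_set (nsets {..<l} k)" if "medium t v l" "i < r" for l i
      using x that set_pmf_random_order[of "{..<l}" k] unfolding sA x_eq by (auto simp: PiE_dflt_def)
    then show ?thesis
      unfolding x_eq y_eq using induced_result_density[OF res V p] t v by simp
  qed
  show "1 \<le> measure_pmf.expectation D (\<lambda>(V, \<C>). covering_density t V \<C>)"
    by (rule rel_pmf_expectation_bounds(1)[OF rel fA bd])
  have "measure_pmf.expectation D (\<lambda>(V, \<C>). covering_density t V \<C>) \<le> measure_pmf.expectation ?A ?Z"
    by (rule rel_pmf_expectation_bounds(2)[OF rel fA bd])
  also have "\<dots> = real (k choose t) / real (v choose t) *
      (\<Sum>H\<in>hyperplanes t p. measure_pmf.expectation ?A (\<lambda>(\<omega>, V). real (induced_size_bound t p v \<omega> V H)))"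
    unfolding case_prod_beta integral_mult_right_zero
    by (subst Bochner_Integration.integral_sum) (simp_all add: int)
  also have "\<dots> \<le> real (k choose t) / real (v choose t) * (\<Sum>H\<in>hyperplanes t p. ?b)"
    using expectation_induced_size_bound[OF t v pc r greedy c]
    by (intro mult_left_mono sum_mono) auto
  also have "\<dots> \<le> real (k choose t) / real (v choose t) * (real (p ^ t) * (real p / (real p - 1)) * ?b)"
  proof (rule mult_left_mono)
    have p1: "1 < real p" using p prime_gt_1_nat by simp
    have "real (card (hyperplanes t p) * (p - 1)) \<le> real (p ^ t * p)"
      using card_hyperplanes_le[OF p, of t] by (simp only: of_nat_le_iff)
    then have "real (card (hyperplanes t p)) * (real p - 1) \<le> real (p ^ t) * real p"
      using p1 by (simp add: of_nat_diff)
    then have "real (card (hyperplanes t p)) \<le> real (p ^ t) * real p / (real p - 1)"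
      using p1 by (simp add: le_divide_eq)
    \<comment> \<open>Enlarging the number of summands requires a nonnegative common bound. It is
      nonnegative because it dominates the expectation of a nonnegative variable for any one
      hyperplane.\<close>
    moreover have "0 \<le> ?b" if H: "H \<in> hyperplanes t p" for H
    proof -
      have "0 \<le> measure_pmf.expectation ?A (\<lambda>(\<omega>, V). real (induced_size_bound t p v \<omega> V H))"
        by (rule Bochner_Integration.integral_nonneg) (simp add: case_prod_beta)
      then show ?thesis using expectation_induced_size_bound[OF t v pc r greedy c H] by linarith
    qed
    \<comment> \<open>Witness: the equation with all coefficients 1 and constant 0.\<close>
    moreover have "hyperplanes t p \<noteq> {}"
      unfolding hyperplanes_eq using t p1 by (auto simp: cong_def intro!: exI[of _ "\<lambda>i. 1"] exI[of _ 0])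
    ultimately have b0: "0 \<le> ?b" and "real (card (hyperplanes t p)) \<le> real (p ^ t) * (real p / (real p - 1))"
      by auto
    then show "(\<Sum>H\<in>hyperplanes t p. ?b) \<le> real (p ^ t) * (real p / (real p - 1)) * ?b"
      unfolding sum_constant by (intro mult_right_mono)
  qed simp
  finally show "measure_pmf.expectation D (\<lambda>(V, \<C>). covering_density t V \<C>) \<le>
      real (k choose t) / real (v choose t) * (real (p ^ t) * (real p / (real p - 1)) * ?b)" .
qed

text \<open>The first term is governed by \<open>p ^ t * plane_moment t p v t\<close>,
  asymptotically \<open>v choose t\<close>; the deviation term is of smaller order by
  \<open>plane_deviation_tendsto_0\<close>.\<close>

lemma density_bound_tendsto:
  fixes p :: "nat \<Rightarrow> nat"
  assumes t: "2 \<le> t" and p: "filterlim p at_top sequentially"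
    and \<mu>: "filterlim (\<lambda>v. real v / real (p v)) at_top sequentially"
  shows "(\<lambda>v. q / real (v choose t) * (real (p v ^ t) * (real (p v) / (real (p v) - 1)) *
        (c * plane_moment t (p v) v t + 256 / (real v / real (p v))\<^sup>2 * plane_deviation t (p v) v)))
      \<longlonglongrightarrow> q * c"
proof -
  let ?\<mu> = "\<lambda>v. real v / real (p v)"
  have "(\<lambda>n. real n / (real n - 1)) \<longlonglongrightarrow> 1" by real_asymp
  then have P: "(\<lambda>v. real (p v) / (real (p v) - 1)) \<longlonglongrightarrow> 1" by (rule filterlim_compose[OF _ p])
  have "(\<lambda>v. q * (real (p v) / (real (p v) - 1)) *
      ((c * (plane_moment t (p v) v t / ?\<mu> v ^ t) + 256 * (plane_deviation t (p v) v / ?\<mu> v ^ (t + 2))) /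
       (real (v choose t) / real v ^ t))) \<longlonglongrightarrow> q * 1 * ((c * (1 / fact t) + 256 * 0) / (1 / fact t))"
    by (intro tendsto_mult tendsto_divide tendsto_add tendsto_const P plane_moment_tendsto[OF t p]
      plane_deviation_tendsto_0[OF t p \<mu>] binomial_ratio_tendsto) simp
  then have lim: "(\<lambda>v. q * (real (p v) / (real (p v) - 1)) *
      ((c * (plane_moment t (p v) v t / ?\<mu> v ^ t) + 256 * (plane_deviation t (p v) v / ?\<mu> v ^ (t + 2))) /
       (real (v choose t) / real v ^ t))) \<longlonglongrightarrow> q * c" by simp
  have "\<forall>\<^sub>F v in sequentially. 2 \<le> p v" using p by (simp add: filterlim_at_top)
  with eventually_ge_at_top[of "Suc t"]
  have "\<forall>\<^sub>F v in sequentially. q * (real (p v) / (real (p v) - 1)) *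
      ((c * (plane_moment t (p v) v t / ?\<mu> v ^ t) + 256 * (plane_deviation t (p v) v / ?\<mu> v ^ (t + 2))) /
       (real (v choose t) / real v ^ t)) =
      q / real (v choose t) * (real (p v ^ t) * (real (p v) / (real (p v) - 1)) *
        (c * plane_moment t (p v) v t + 256 / (?\<mu> v)\<^sup>2 * plane_deviation t (p v) v))"
  proof eventually_elim
    case (elim v)
    have "q * R * ((c * (A / (V / B)) + 256 * (E / ((V / B) * m))) / (C / V)) =
        q / C * (B * R * (c * A + 256 / m * E))"
      if "0 < V" "0 < B" "0 < C" "0 < m" for R A V B E m C :: real
      using that by (simp add: field_simps)
    note eq = this
    have "?\<mu> v ^ (t + 2) = real v ^ t / real (p v) ^ t * (?\<mu> v)\<^sup>2"
      by (simp only: power_add power_divide)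
    then show ?case
      unfolding power_divide[of "real v" "real (p v)" t] of_nat_power
      by (simp only:) (rule eq, use elim in auto)
  qed
  with lim show ?thesis by (rule Lim_transform_eventually)
qed

theorem theorem4:
  fixes k t :: nat
    and p r :: "nat \<Rightarrow> nat"
    and D :: "nat \<Rightarrow> (point set \<times> point set multiset) pmf"
  assumes "2 \<le> t" and "t \<le> k"
    and "\<forall>\<^sub>F v in sequentially. prime_choice t v (p v)"
    and "\<forall>\<^sub>F v in sequentially. 1 \<le> r v"
    and "(\<lambda>v. real (r v)) \<in> O(\<lambda>v. ln (ell t v))"
    and "\<forall>\<^sub>F v in sequentially. induced_algorithm k t (p v) (r v) v (D v)"
  shows "(\<lambda>v. measure_pmf.expectation (D v) (\<lambda>(V, \<C>). covering_density t V \<C>)) \<longlonglongrightarrow> 1"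
proof -
  note t = assms(1,2)
  \<comment> \<open>These two bounds force both \<open>p\<close> and the mean intersection size
    \<open>v / p\<close> to infinity.\<close>
  have pb: "\<forall>\<^sub>F v in sequentially. real v powr (1 / real t) \<le> real (p v) \<and> 4 * ell t v \<le> real v / real (p v)"
    using assms(3) eventually_ge_at_top[of "18 * t"]
    by eventually_elim (use prime_choice_bounds[OF t(1)] in blast)
  have "filterlim (\<lambda>v. real v powr (1 / real t)) at_top sequentially"
    using t by real_asymp
  then have "filterlim (\<lambda>v. real (p v)) at_top sequentially"
    by (rule filterlim_at_top_mono) (use pb in \<open>simp add: eventually_conj_iff\<close>)
  then have p: "filterlim p at_top sequentially" by (simp add: filterlim_sequentially_iff_filterlim_real)
  have "filterlim (\<lambda>v. 4 * ell t v) at_top sequentially"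
    by (intro filterlim_tendsto_pos_mult_at_top[OF tendsto_const] filterlim_ell_at_top t) simp
  then have \<mu>: "filterlim (\<lambda>v. real v / real (p v)) at_top sequentially"
    by (rule filterlim_at_top_mono) (use pb in \<open>simp add: eventually_conj_iff\<close>)
  have Q: "0 < real (k choose t)" using t by simp
  show ?thesis
  proof (rule tendstoI)
    fix e :: real assume e: "0 < e"
    \<comment> \<open>With this choice \<open>(k choose t) * c = 1 + e / 2\<close>, so the upper
      bound is eventually below \<open>1 + e\<close>; the lower bound 1 needs no limit.\<close>
    define \<epsilon> where "\<epsilon> = e / (2 * real (k choose t))"
    define c where "c = 1 / real (k choose t) + \<epsilon>"
    have \<epsilon>: "0 < \<epsilon>" and c: "0 \<le> c" and Qc: "real (k choose t) * c < 1 + e"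
      unfolding c_def \<epsilon>_def using Q e by (simp_all add: algebra_simps)
    have "\<forall>\<^sub>F l in sequentially. measure_pmf.expectation (pmf_of_set (permutations_of_set (nsets {..<l} k)))
        (\<lambda>xs. real (greedy_size t {..<l} xs)) \<le> c * real (l choose t)"
      unfolding c_def using t by (intro expectation_greedy_size_eventually_le \<epsilon>) auto
    then obtain l0 where l0: "measure_pmf.expectation (pmf_of_set (permutations_of_set (nsets {..<l} k)))
        (\<lambda>xs. real (greedy_size t {..<l} xs)) \<le> c * real (l choose t)" if "l0 \<le> l" for l
      unfolding eventually_sequentially by blast
    have "\<forall>\<^sub>F v in sequentially. real l0 \<le> ell t v"
      using filterlim_ell_at_top[OF t(1)] by (simp add: filterlim_at_top)
    moreover have "\<forall>\<^sub>F v in sequentially. real (k choose t) / real (v choose t) *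
        (real (p v ^ t) * (real (p v) / (real (p v) - 1)) *
        (c * plane_moment t (p v) v t + 256 / (real v / real (p v))\<^sup>2 * plane_deviation t (p v) v)) < 1 + e"
      using order_tendstoD(2)[OF density_bound_tendsto[OF t(1) p \<mu>] Qc] .
    moreover note eventually_ge_at_top[of "18 * t"] assms(3,4,6)
    ultimately show "\<forall>\<^sub>F v in sequentially.
        dist (measure_pmf.expectation (D v) (\<lambda>(V, \<C>). covering_density t V \<C>)) 1 < e"
    proof eventually_elim
      case (elim v)
      \<comment> \<open>Medium sizes exceed \<open>ell t v\<close>, which is at least
        \<open>l0\<close> by now, so one threshold serves all precomputed coverings at once.\<close>
      have "measure_pmf.expectation (pmf_of_set (permutations_of_set (nsets {..<l} k)))
        (\<lambda>xs. real (greedy_size t {..<l} xs)) \<le> c * real (l choose t)" if "medium t v l" for l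
        using that elim(1) unfolding medium_def by (intro l0) linarith
      from expectation_density_bounds[OF t elim(3,4,5) this c elim(6)] elim(2)
      show ?case unfolding dist_real_def by linarith
    qed
  qed
qed

end
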